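(* Let $X\subset\mathbb{R}^n$ be unimodular, and let $\mathcal{Z}_-(X)=\mathrm{int}(Z(X))\cap\mathbb{Z}^n$ be the set of integer points in the interior of the zonotope $Z(X)=\{\sum_{x\in X}t_xx:t\in[0,1]^X\}$. Then $$\Pi(\mathcal{Z}_-(X))=\mathcal{P}_-(X)=\ker\mathcal{I}_-(X).$$
   Context: $X$ is a finite multiset of nonzero vectors in $\mathbb{R}^n$ spanning $\mathbb{R}^n$ (repeated vectors are treated as distinct elements; subsets, set differences and cardinalities are taken with multiplicity). $X$ is unimodular if $X\subset\mathbb{Z}^n$ and every $B\subset X$ that is a basis of $\mathbb{R}^n$ satisfies $\det B=\pm1$. $\Pi=\mathbb{C}[t_1,\dots,t_n]$. For a nonzero power series $f=f_0+f_1+\cdots$ with $f_j$ homogeneous of degree $j$, $f_\downarrow$ is the nonzero $f_j$ of smallest $j$; $0_\downarrow=0$. For finite $\sigma\subset\mathbb{R}^n$, $\mathrm{Exp}(\sigma)=\mathrm{span}_{\mathbb{C}}\{t\mapsto e^{\alpha\cdot t}:\alpha\in\sigma\}$ and $\Pi(\sigma)=\mathrm{span}\{f_\downarrow:f\in\mathrm{Exp}(\sigma)\}$. For $y\in\mathbb{R}^n$, $p_y(t)=y\cdot t$; $p_Y=\prod_{y\in Y}p_y$ (with $p_\emptyset=1$). For a multisubset $W\subset X$, $\mathcal{P}(W)=\mathrm{span}_{\mathbb{C}}\{p_Y:Y\subset W,\ \mathrm{rank}(W\setminus Y)=n\}$ (which is $\{0\}$ if $\mathrm{rank}\,W<n$),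 and $\mathcal{P}_-(X)=\bigcap_{x\in X}\mathcal{P}(X\setminus x)$, where $X\setminus x$ is $X$ with the single element $x$ removed. $\mathcal{F}(X)$ is the set of linear subspaces $H\subset\mathbb{R}^n$ with $\dim H=n-1$ and $\mathrm{span}(X\cap H)=H$; $\eta_H$ is a nonzero normal to $H$, $m(H)=\#(X\setminus H)$, and $\mathcal{I}_-(X)$ is the ideal generated by $p_{\eta_H}^{m(H)-1}$, $H\in\mathcal{F}(X)$. For a homogeneous ideal $I$, $\ker I=\{p\in\Pi:q(D)p=0\ \forall q\in I\}$ with $q(D)=q(\partial/\partial t_1,\dots,\partial/\partial t_n)$. *)

theory Defs
  imports
    "HOL-Analysis.Analysis"
    "HOL-Library.Multiset"
    "HOL-Library.Poly_Mapping"
    "HOL-Library.Function_Algebras"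
begin

section \<open>Complex polynomials in variables indexed by a finite type\<close>

text \<open>A polynomial maps each exponent vector to its coefficient;
  multiplication on \<^typ>\<open>'a \<Rightarrow>\<^sub>0 'b\<close> is convolution.\<close>

type_synonym 'n cpoly = "('n \<Rightarrow>\<^sub>0 nat) \<Rightarrow>\<^sub>0 complex"

definition pscale :: "complex \<Rightarrow> 'n cpoly \<Rightarrow> 'n cpoly" where
  "pscale c p = Poly_Mapping.single 0 c * p"

global_interpretation cpoly: vector_space "pscale :: complex \<Rightarrow> 'n cpoly \<Rightarrow> 'n cpoly"
  by standard
    (simp_all add: pscale_def algebra_simps single_add mult_single flip: mult.assoc)

global_interpretation cpoly_ideal: module "(*) :: 'n cpoly \<Rightarrow> 'n cpoly \<Rightarrow> 'n cpoly"
  by standard (simp_all add: algebra_simps)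

definition homogeneous :: "nat \<Rightarrow> ('n::finite) cpoly \<Rightarrow> bool" where
  "homogeneous d p \<longleftrightarrow> (\<forall>m\<in>Poly_Mapping.keys p. (\<Sum>i\<in>UNIV. Poly_Mapping.lookup m i) = d)"

definition peval :: "('n::finite) cpoly \<Rightarrow> real ^ 'n \<Rightarrow> complex" where
  "peval p t = (\<Sum>m\<in>Poly_Mapping.keys p.
     Poly_Mapping.lookup p m * (\<Prod>i\<in>UNIV. of_real (t $ i) ^ Poly_Mapping.lookup m i))"

text \<open>The truncated difference of exponents is harmless: the coefficient vanishes
  when the variable does not occur.\<close>

definition pdiff :: "'n \<Rightarrow> 'n cpoly \<Rightarrow> 'n cpoly" where
  "pdiff i p = (\<Sum>m\<in>Poly_Mapping.keys p.
     Poly_Mapping.single (m - Poly_Mapping.single i 1)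
       (of_nat (Poly_Mapping.lookup m i) * Poly_Mapping.lookup p m))"

lemma lookup_pdiff:
  "Poly_Mapping.lookup (pdiff i p) m =
     of_nat (Suc (Poly_Mapping.lookup m i)) * Poly_Mapping.lookup p (m + Poly_Mapping.single i 1)"
proof -
  let ?e = "Poly_Mapping.single i (1::nat)"
  have eq: "k = m + ?e" if "k - ?e = m" "Poly_Mapping.lookup k i \<noteq> 0" for k
  proof (rule poly_mapping_eqI)
    fix j
    show "Poly_Mapping.lookup k j = Poly_Mapping.lookup (m + ?e) j"
      using that by (auto simp: lookup_add lookup_minus lookup_single when_def)
  qed
  have "Poly_Mapping.lookup (pdiff i p) m =
     (\<Sum>k\<in>Poly_Mapping.keys p.
        if k = m + ?e then of_nat (Poly_Mapping.lookup k i) * Poly_Mapping.lookup p k else 0)"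
    unfolding pdiff_def lookup_sum
    by (rule sum.cong, simp, auto simp: lookup_single when_def, metis One_nat_def eq)
  also have "\<dots> = of_nat (Suc (Poly_Mapping.lookup m i)) * Poly_Mapping.lookup p (m + ?e)"
    by (auto simp: sum.delta lookup_add in_keys_iff)
  finally show ?thesis .
qed

lemma pdiff_commute: "pdiff i (pdiff j p) = pdiff j (pdiff i p)"
  by (rule poly_mapping_eqI)
    (auto simp: lookup_pdiff lookup_add lookup_single when_def ac_simps)

definition mdiff :: "('n::finite \<Rightarrow>\<^sub>0 nat) \<Rightarrow> 'n cpoly \<Rightarrow> 'n cpoly" where
  "mdiff m p = Finite_Set.fold (\<lambda>i. pdiff i ^^ Poly_Mapping.lookup m i) p UNIV"

text \<open>The fold above is independent of the order of the variables.\<close>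

lemma comp_fun_commute_pdiff:
  "comp_fun_commute (\<lambda>i::'a. pdiff i ^^ Poly_Mapping.lookup m i)"
proof
  fix i j :: 'a
  have 1: "pdiff i ((pdiff j ^^ k) p) = (pdiff j ^^ k) (pdiff i p)" for k p
    by (induction k) (simp_all add: pdiff_commute[of i j])
  have "(pdiff i ^^ l) ((pdiff j ^^ k) p) = (pdiff j ^^ k) ((pdiff i ^^ l) p)" for k l p
    by (induction l) (simp_all add: 1)
  then show "(pdiff j ^^ Poly_Mapping.lookup m j) \<circ> (pdiff i ^^ Poly_Mapping.lookup m i) =
      (pdiff i ^^ Poly_Mapping.lookup m i) \<circ> (pdiff j ^^ Poly_Mapping.lookup m j)"
    by (simp add: fun_eq_iff)
qed

definition diff_op :: "('n::finite) cpoly \<Rightarrow> 'n cpoly \<Rightarrow> 'n cpoly" where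
  "diff_op q p = (\<Sum>m\<in>Poly_Mapping.keys q. pscale (Poly_Mapping.lookup q m) (mdiff m p))"

definition ideal_ker :: "('n::finite) cpoly set \<Rightarrow> 'n cpoly set" where
  "ideal_ker I = {p. \<forall>q\<in>I. diff_op q p = 0}"


section \<open>The least map\<close>

global_interpretation cfun: vector_space "\<lambda>(c::complex) (f :: 'a \<Rightarrow> complex) t. c * f t"
  by standard (simp_all add: fun_eq_iff algebra_simps)

definition Exp_space :: "(real ^ 'n) set \<Rightarrow> (real ^ 'n \<Rightarrow> complex) set" where
  "Exp_space \<sigma> = cfun.span ((\<lambda>\<alpha> t. exp (of_real (\<alpha> \<bullet> t))) ` \<sigma>)"

definition homog_expansion :: "(real ^ 'n \<Rightarrow> complex) \<Rightarrow> (nat \<Rightarrow> ('n::finite) cpoly) \<Rightarrow> bool" where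
  "homog_expansion f c \<longleftrightarrow>
     (\<forall>j. homogeneous j (c j)) \<and> (\<forall>t. (\<lambda>j. peval (c j) t) sums f t)"

text \<open>The least part of a power series, given by its sequence of homogeneous components.\<close>

definition least_part :: "(nat \<Rightarrow> 'n cpoly) \<Rightarrow> 'n cpoly" where
  "least_part c = (if \<forall>j. c j = 0 then 0 else c (LEAST j. c j \<noteq> 0))"

definition Pi_space :: "(real ^ 'n) set \<Rightarrow> ('n::finite) cpoly set" where
  "Pi_space \<sigma> = cpoly.span {least_part c | c f. f \<in> Exp_space \<sigma> \<and> homog_expansion f c}"


section \<open>Zonotopal spaces\<close>

definition linear_form :: "real ^ 'n \<Rightarrow> ('n::finite) cpoly" where
  "linear_form y =
     (\<Sum>i\<in>UNIV. Poly_Mapping.single (Poly_Mapping.single i 1) (of_real (y $ i)))"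

definition prod_form :: "(real ^ 'n) multiset \<Rightarrow> ('n::finite) cpoly" where
  "prod_form Y = prod_mset (image_mset linear_form Y)"

definition P_central :: "(real ^ 'n) multiset \<Rightarrow> ('n::finite) cpoly set" where
  "P_central W =
     cpoly.span {prod_form Y | Y. Y \<subseteq># W \<and> dim (set_mset (W - Y)) = CARD('n)}"

definition P_minus :: "(real ^ 'n) multiset \<Rightarrow> ('n::finite) cpoly set" where
  "P_minus X = (\<Inter>x\<in>set_mset X. P_central (X - {#x#}))"

definition facet_hyperplanes :: "(real ^ 'n) multiset \<Rightarrow> (real ^ 'n) set set" where
  "facet_hyperplanes X =
     {H. subspace H \<and> dim H = CARD('n) - 1 \<and> span (set_mset X \<inter> H) = H}"

definition hyperplane_mult :: "(real ^ 'n) multiset \<Rightarrow> (real ^ 'n) set \<Rightarrow> nat" where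
  "hyperplane_mult X H = size (filter_mset (\<lambda>x. x \<notin> H) X)"

text \<open>The function \<open>\<eta>\<close> assigns to each facet hyperplane a chosen normal vector. The
  exponent is a true difference when the multiset spans, as the multiplicity is then positive.\<close>

definition I_minus ::
  "(real ^ 'n) multiset \<Rightarrow> ((real ^ 'n) set \<Rightarrow> real ^ 'n) \<Rightarrow> ('n::finite) cpoly set" where
  "I_minus X \<eta> =
     cpoly_ideal.span
       ((\<lambda>H. linear_form (\<eta> H) ^ (hyperplane_mult X H - 1)) ` facet_hyperplanes X)"

definition integer_points :: "(real ^ 'n) set" where
  "integer_points = {z. \<forall>i. z $ i \<in> \<int>}"

text \<open>A multisubset that is a basis has no repeated elements, so bases are
  subsets of the underlying set; \<open>b\<close> runs through all orderings of the basis.\<close>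

definition unimodular :: "(real ^ 'n) multiset \<Rightarrow> bool" where
  "unimodular X \<longleftrightarrow>
     set_mset X \<subseteq> integer_points \<and>
     (\<forall>B \<subseteq> set_mset X. independent B \<and> span B = UNIV \<longrightarrow>
        (\<forall>b :: 'n \<Rightarrow> real ^ 'n. bij_betw b UNIV B \<longrightarrow> det (\<chi> i. b i) = 1 \<or> det (\<chi> i. b i) = -1))"

text \<open>Each of the \<open>count X x\<close> copies of \<open>x\<close> has its own coefficient.\<close>

definition zonotope :: "(real ^ 'n) multiset \<Rightarrow> (real ^ 'n) set" where
  "zonotope X =
     {\<Sum>x\<in>set_mset X. \<Sum>k<count X x. t x k *\<^sub>R x |
        t :: real ^ 'n \<Rightarrow> nat \<Rightarrow> real. \<forall>x k. t x k \<in> {0..1}}"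

definition Z_minus :: "(real ^ 'n) multiset \<Rightarrow> (real ^ 'n) set" where
  "Z_minus X = interior (zonotope X) \<inter> integer_points"

end

theory Submission
  imports Defs "HOL-Computational_Algebra.Polynomial"
begin

text \<open>
  Both equalities are proved by deletion and contraction, contraction by a subspace \<open>U\<close> being
  restriction of functions to the orthogonal complement of \<open>U\<close>. If \<open>f\<close> is killed by the powers
  \<open>m(H) - \<delta>\<close> of the facet derivatives (\<open>\<delta> = 0\<close> central, \<open>\<delta> = 1\<close> internal), then so is its
  restriction to the orthogonal complement of an element \<open>x\<close>, with respect to the contraction; and
  if \<open>p\<^sub>x g\<close> is killed then \<open>g\<close> is killed with respect to the deletion.
  For \<open>\<delta> = 0\<close> this gives \<open>P(X) = ker I(X)\<close> for every spanning \<open>X\<close>, and intersecting over the deletions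
  \<open>X - x\<close> gives \<open>P\<^sub>- = ker I\<^sub>-\<close>. For unimodular \<open>X\<close>, the least part of an exponential sum over
  the interior lattice points is in the kernel, because a facet normal takes only \<open>m(H) - 1\<close>
  values on these points. Conversely, a kernel element is lifted from the contraction as an
  exponential sum (interior lattice points lift), and the lower order terms that this creates are
  divisible by \<open>p\<^sub>x\<close>, so they are removed by sums \<open>(e\<^sup>x - 1) F\<close> with \<open>F\<close> from the deletion.
\<close>

section \<open>Polynomials as functions\<close>

text \<open>No quotient space is ever formed. Everything stays in R^n and is taken relative to a
  subspace U: polynomials on \<open>U\<^sup>\<bottom>\<close>, zonotopes thickened by U, and always
  the lattice Z^n. An induction over X with U arbitrary then covers deletion and contraction at
  once.

  The equations D_v^k f = 0 are read as degree bounds on lines in direction v. Such bounds survive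
  restriction to a subspace, and for a nonzero f the factor x.t raises the degree exactly when x.v
  is nonzero.

  The obstacle is a coloop x, where X - x no longer spans. Then one hyperplane contains all of X -
  x, an exponent becomes 0, and the kernel in question vanishes.

  Apart from the integrality of X, unimodularity enters only through facet normals. Scaled to be
  integral on Z^n with values -1, 0, 1 on X, a normal maps the interior of the zonotope into an open
  interval from -M to N with M + N = m(H); the m(H) - 1 integers in it are the roots of a linear
  recurrence for directional derivatives.\<close>

lemma cpoly_sum_monomials:
  "p = (\<Sum>m\<in>Poly_Mapping.keys p. Poly_Mapping.single m (Poly_Mapping.lookup p m))"
  by (rule poly_mapping_eqI)
    (auto simp: lookup_sum lookup_single when_def in_keys_iff)

lemma cpoly_induct [case_names single add]:
  assumes single: "\<And>m c. P (Poly_Mapping.single m c)"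
    and add: "\<And>p q. P p \<Longrightarrow> P q \<Longrightarrow> P (p + q)"
  shows "P (p :: 'n cpoly)"
proof -
  have "P (\<Sum>m\<in>A. Poly_Mapping.single m (Poly_Mapping.lookup p m))"
    if "finite A" for A
    using that
  proof induction
    case empty
    show ?case using single[of 0 0] by simp
  qed (auto intro: assms)
  then show ?thesis
    using cpoly_sum_monomials[of p] finite_keys[of p] by metis
qed

lemma lookup_pscale [simp]: "Poly_Mapping.lookup (pscale c p) m = c * Poly_Mapping.lookup p m"
proof (induction p rule: cpoly_induct)
  case (single k d)
  then show ?case by (simp add: pscale_def mult_single lookup_single when_def)
next
  case (add p q)
  then show ?case by (simp add: cpoly.scale_right_distrib lookup_add algebra_simps)
qed

lemma sum_keys_superset:
  assumes "finite A" "Poly_Mapping.keys p \<subseteq> A" "\<And>m. g m 0 = 0"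
  shows "(\<Sum>m\<in>Poly_Mapping.keys p. g m (Poly_Mapping.lookup p m)) =
    (\<Sum>m\<in>A. g m (Poly_Mapping.lookup p m))"
  by (rule sum.mono_neutral_left) (use assms in \<open>auto simp: in_keys_iff\<close>)

text \<open>The supports of p, q and p + q differ, so all three sums are moved to the union of the
  first two, where vanishing terms do no harm. \<open>peval\<close>, \<open>line_poly\<close> and
  \<open>diff_op\<close> get their additivity from here.\<close>

lemma sum_keys_add:
  assumes "\<And>m. g m 0 = 0" "\<And>m a b. g m (a + b) = g m a + g m b"
  shows "(\<Sum>m\<in>Poly_Mapping.keys (p + q). g m (Poly_Mapping.lookup (p + q) m)) =
    (\<Sum>m\<in>Poly_Mapping.keys p. g m (Poly_Mapping.lookup p m)) +
    (\<Sum>m\<in>Poly_Mapping.keys q. g m (Poly_Mapping.lookup q m))"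
proof -
  let ?A = "Poly_Mapping.keys p \<union> Poly_Mapping.keys q"
  have A: "finite ?A" "Poly_Mapping.keys p \<subseteq> ?A" "Poly_Mapping.keys q \<subseteq> ?A"
    "Poly_Mapping.keys (p + q) \<subseteq> ?A"
    using Poly_Mapping.keys_add[of p q] by auto
  show ?thesis
    unfolding sum_keys_superset[where g = g, OF A(1,2) assms(1)]
      sum_keys_superset[where g = g, OF A(1,3) assms(1)]
      sum_keys_superset[where g = g, OF A(1,4) assms(1)]
    by (simp add: lookup_add assms(2) sum.distrib)
qed

lemma sum_keys_single:
  assumes "\<And>m. g m 0 = 0"
  shows "(\<Sum>k\<in>Poly_Mapping.keys (Poly_Mapping.single m c).
    g k (Poly_Mapping.lookup (Poly_Mapping.single m c) k)) = g m c"
  using assms by (cases "c = 0") auto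

text \<open>The restriction of p to the line t + s v, kept as a formal polynomial in s so that
  degrees and coefficients along v can be compared algebraically.\<close>

definition line_poly :: "real ^ 'n \<Rightarrow> real ^ 'n \<Rightarrow> ('n::finite) cpoly \<Rightarrow> complex poly" where
  "line_poly t v p = (\<Sum>m\<in>Poly_Mapping.keys p. smult (Poly_Mapping.lookup p m)
     (\<Prod>i\<in>UNIV. [:of_real (t $ i), of_real (v $ i):] ^ Poly_Mapping.lookup m i))"

lemma line_poly_single:
  "line_poly t v (Poly_Mapping.single m c) =
     smult c (\<Prod>i\<in>UNIV. [:of_real (t $ i), of_real (v $ i):] ^ Poly_Mapping.lookup m i)"
  unfolding line_poly_def by (rule sum_keys_single) simp

lemma line_poly_add: "line_poly t v (p + q) = line_poly t v p + line_poly t v q"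
  unfolding line_poly_def by (rule sum_keys_add) (simp_all add: smult_add_left)

lemma line_poly_pscale: "line_poly t v (pscale c p) = smult c (line_poly t v p)"
proof (induction p rule: cpoly_induct)
  case (single m d)
  then show ?case by (simp add: pscale_def mult_single line_poly_single)
qed (simp add: cpoly.scale_right_distrib line_poly_add smult_add_right)

lemma line_poly_0 [simp]: "line_poly t v 0 = 0"
  by (simp add: line_poly_def)

lemma line_poly_sum: "line_poly t v (sum f A) = (\<Sum>a\<in>A. line_poly t v (f a))"
  by (induction A rule: infinite_finite_induct) (simp_all add: line_poly_add)

lemma poly_line_poly: "poly (line_poly t v p) (of_real s) = peval p (t + s *\<^sub>R v)"
  by (simp add: line_poly_def peval_def poly_sum poly_prod algebra_simps)

lemma peval_single:
  "peval (Poly_Mapping.single m c) t = c * (\<Prod>i\<in>UNIV. of_real (t $ i) ^ Poly_Mapping.lookup m i)"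
  unfolding peval_def by (rule sum_keys_single) simp

lemma peval_add: "peval (p + q) t = peval p t + peval q t"
  unfolding peval_def by (rule sum_keys_add) (simp_all add: algebra_simps)

lemma peval_0 [simp]: "peval 0 t = 0"
  by (simp add: peval_def)

lemma peval_sum: "peval (sum f A) t = (\<Sum>a\<in>A. peval (f a) t)"
  by (induction A rule: infinite_finite_induct) (simp_all add: peval_add)

lemma peval_mult: "peval (p * q) t = peval p t * peval q t"
proof (induction p rule: cpoly_induct)
  case (single m c)
  show ?case
  proof (induction q rule: cpoly_induct)
    case (single k d)
    show ?case
      by (simp add: mult_single peval_single lookup_add power_add prod.distrib)
  qed (simp add: peval_add ring_distribs)
qed (simp add: peval_add ring_distribs)

lemma peval_pscale: "peval (pscale c p) t = c * peval p t"
  by (simp add: pscale_def peval_mult peval_single)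

lemma peval_diff: "peval (p - q) t = peval p t - peval q t"
  using peval_add[of "p - q" q t] by simp

lemma peval_1 [simp]: "peval 1 t = 1"
  using peval_single[of 0 1 t] by simp

lemma prod_single_exponent:
  "(\<Prod>j\<in>UNIV. g j ^ Poly_Mapping.lookup (Poly_Mapping.single i (1::nat)) j) = g (i::'n::finite)"
  by (simp add: lookup_single when_def if_distrib prod.delta cong: if_cong)

lemma peval_linear_form: "peval (linear_form y) t = of_real (y \<bullet> t)"
  unfolding linear_form_def
  by (simp only: peval_sum peval_single prod_single_exponent) (simp add: inner_vec_def)

lemma peval_prod_form: "peval (prod_form Y) t = (\<Prod>y\<in>#Y. of_real (y \<bullet> t))"
  by (induction Y) (simp_all add: prod_form_def peval_mult peval_linear_form)

section \<open>Constant coefficient differential operators\<close>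

lemma pdiff_single:
  "pdiff i (Poly_Mapping.single m c) =
     Poly_Mapping.single (m - Poly_Mapping.single i 1) (of_nat (Poly_Mapping.lookup m i) * c)"
  unfolding pdiff_def by (rule sum_keys_single) simp

lemma lookup_pdiff_funpow:
  "Poly_Mapping.lookup ((pdiff i ^^ a) p) m =
     pochhammer (of_nat (Suc (Poly_Mapping.lookup m i))) a *
     Poly_Mapping.lookup p (m + Poly_Mapping.single i a)"
proof (induction a arbitrary: m)
  case (Suc a)
  show ?case
    by (simp add: Suc lookup_pdiff pochhammer_rec lookup_add add.assoc single_add [symmetric]
        algebra_simps)
qed simp

lemma sum_single_lookup:
  "(\<Sum>i\<in>UNIV. Poly_Mapping.single i (Poly_Mapping.lookup m i)) = (m :: 'n::finite \<Rightarrow>\<^sub>0 nat)"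
  by (rule poly_mapping_eqI) (simp add: lookup_sum lookup_single when_def)

text \<open>The rising factorials are the factors left by repeated differentiation. With this
  formula in place of the fold, the laws of \<open>mdiff\<close> reduce to comparing
  coefficients.\<close>

lemma lookup_mdiff:
  fixes m k :: "'n::finite \<Rightarrow>\<^sub>0 nat"
  shows "Poly_Mapping.lookup (mdiff m p) k =
    (\<Prod>i\<in>UNIV. pochhammer (of_nat (Suc (Poly_Mapping.lookup k i))) (Poly_Mapping.lookup m i)) *
    Poly_Mapping.lookup p (k + m)"
proof -
  interpret comp_fun_commute "\<lambda>i::'n. pdiff i ^^ Poly_Mapping.lookup m i"
    by (rule comp_fun_commute_pdiff)
  have "Poly_Mapping.lookup (Finite_Set.fold (\<lambda>i. pdiff i ^^ Poly_Mapping.lookup m i) p S) k =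
    (\<Prod>i\<in>S. pochhammer (of_nat (Suc (Poly_Mapping.lookup k i))) (Poly_Mapping.lookup m i)) *
    Poly_Mapping.lookup p (k + (\<Sum>i\<in>S. Poly_Mapping.single i (Poly_Mapping.lookup m i)))"
    if "finite S" for S k
    using that
  proof (induction S arbitrary: k)
    case (insert i S)
    have "Poly_Mapping.lookup (k + Poly_Mapping.single i (Poly_Mapping.lookup m i)) j =
      Poly_Mapping.lookup k j" if "j \<in> S" for j
      using that insert.hyps by (auto simp: lookup_add lookup_single when_def)
    then show ?case
      using insert by (simp add: lookup_pdiff_funpow add.assoc)
  qed simp
  from this[OF finite] show ?thesis
    by (simp add: mdiff_def sum_single_lookup)
qed

lemma mdiff_add: "mdiff m (p + q) = mdiff m p + mdiff m q"
  by (rule poly_mapping_eqI) (simp add: lookup_mdiff lookup_add algebra_simps)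

lemma mdiff_pscale: "mdiff m (pscale c p) = pscale c (mdiff m p)"
  by (rule poly_mapping_eqI) (simp add: lookup_mdiff)

lemma mdiff_0_right [simp]: "mdiff m 0 = 0"
  by (rule poly_mapping_eqI) (simp add: lookup_mdiff)

lemma mdiff_plus_exponent: "mdiff (m + k) p = mdiff m (mdiff k p)"
proof (rule poly_mapping_eqI)
  fix l
  have *: "pochhammer (of_nat (Suc a)) (b + c) =
    (pochhammer (of_nat (Suc a)) b * pochhammer (of_nat (Suc (a + b))) c :: complex)" for a b c
    using pochhammer_product[of b "b + c" "of_nat (Suc a) :: complex"] by (simp add: add.assoc)
  show "Poly_Mapping.lookup (mdiff (m + k) p) l = Poly_Mapping.lookup (mdiff m (mdiff k p)) l"
    by (simp only: lookup_mdiff lookup_add * prod.distrib add.assoc mult.assoc)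
qed

lemma mdiff_single: "mdiff (Poly_Mapping.single i 1) p = pdiff i p"
proof (rule poly_mapping_eqI)
  fix k
  have "(\<Prod>j\<in>UNIV. pochhammer (of_nat (Suc (Poly_Mapping.lookup k j)))
      (Poly_Mapping.lookup (Poly_Mapping.single i 1) j)) =
    (\<Prod>j\<in>UNIV. (of_nat (Suc (Poly_Mapping.lookup k j)) :: complex) ^
      (Poly_Mapping.lookup (Poly_Mapping.single i 1) j))"
    by (rule prod.cong) (auto simp: lookup_single when_def)
  then show "Poly_Mapping.lookup (mdiff (Poly_Mapping.single i 1) p) k =
      Poly_Mapping.lookup (pdiff i p) k"
    by (simp only: lookup_mdiff lookup_pdiff prod_single_exponent)
qed

lemma mdiff_0 [simp]: "mdiff 0 p = p"
  by (rule poly_mapping_eqI) (simp add: lookup_mdiff)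

lemma diff_op_single: "diff_op (Poly_Mapping.single m c) p = pscale c (mdiff m p)"
  unfolding diff_op_def by (rule sum_keys_single) simp

lemma diff_op_add_left: "diff_op (q + r) p = diff_op q p + diff_op r p"
  unfolding diff_op_def by (rule sum_keys_add) (simp_all add: cpoly.scale_left_distrib)

lemma diff_op_0_left [simp]: "diff_op 0 p = 0"
  by (simp add: diff_op_def)

lemma diff_op_0_right [simp]: "diff_op q 0 = 0"
  by (simp add: diff_op_def)

lemma diff_op_add_right: "diff_op q (p + r) = diff_op q p + diff_op q r"
  by (simp add: diff_op_def mdiff_add cpoly.scale_right_distrib sum.distrib)

text \<open>Checked on pairs of monomials and extended by additivity. It is what lets the generators
  of an ideal decide its kernel.\<close>

lemma diff_op_mult: "diff_op (q * r) p = diff_op q (diff_op r p)"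
proof (induction q rule: cpoly_induct)
  case (single m c)
  show ?case
  proof (induction r rule: cpoly_induct)
    case (single k d)
    show ?case
      by (simp add: mult_single diff_op_single mdiff_plus_exponent mdiff_pscale)
  qed (simp add: ring_distribs diff_op_add_left diff_op_add_right)
qed (simp add: ring_distribs diff_op_add_left)

lemma diff_op_1 [simp]: "diff_op 1 p = p"
  using diff_op_single[of 0 1 p] by simp

lemma diff_op_power: "diff_op (q ^ k) p = (diff_op q ^^ k) p"
  by (induction k) (simp_all add: diff_op_mult)

lemma diff_op_sum_left: "diff_op (sum f A) p = (\<Sum>a\<in>A. diff_op (f a) p)"
  by (induction A rule: infinite_finite_induct) (simp_all add: diff_op_add_left)

lemma diff_op_linear_form:
  "diff_op (linear_form v) p = (\<Sum>i\<in>UNIV. pscale (of_real (v $ i)) (pdiff i p))"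
  unfolding linear_form_def by (simp only: diff_op_sum_left diff_op_single mdiff_single)

section \<open>Taylor expansion along a line\<close>

lemma smult_sum_right: "smult c (sum f A) = (\<Sum>a\<in>A. smult c (f a))"
  by (induction A rule: infinite_finite_induct) (simp_all add: smult_add_right)

text \<open>The chain rule, verified on monomials by the product rule.\<close>

lemma pderiv_line_poly: "pderiv (line_poly t v p) = line_poly t v (diff_op (linear_form v) p)"
proof (induction p rule: cpoly_induct)
  case (single m c)
  let ?l = "\<lambda>i. [:complex_of_real (t $ i), of_real (v $ i):]"
  let ?m = "Poly_Mapping.lookup m"
  have *: "(\<Prod>j\<in>UNIV. ?l j ^ Poly_Mapping.lookup (m - Poly_Mapping.single i 1) j) =
      (\<Prod>j\<in>UNIV - {i}. ?l j ^ ?m j) * ?l i ^ (?m i - 1)" for i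
  proof -
    have "(\<Prod>j\<in>UNIV. ?l j ^ Poly_Mapping.lookup (m - Poly_Mapping.single i 1) j) =
      ?l i ^ Poly_Mapping.lookup (m - Poly_Mapping.single i 1) i *
      (\<Prod>j\<in>UNIV - {i}. ?l j ^ Poly_Mapping.lookup (m - Poly_Mapping.single i 1) j)"
      by (rule prod.remove) auto
    also have "(\<Prod>j\<in>UNIV - {i}. ?l j ^ Poly_Mapping.lookup (m - Poly_Mapping.single i 1) j) =
        (\<Prod>j\<in>UNIV - {i}. ?l j ^ ?m j)"
      by (rule prod.cong) (auto simp: lookup_minus lookup_single)
    finally show ?thesis
      by (simp add: lookup_minus mult.commute)
  qed
  have **: "pderiv (?l i ^ k) = smult (of_nat k * of_real (v $ i)) (?l i ^ (k - 1))" for i k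
    by (cases k) (simp_all add: pderiv_power_Suc pderiv_pCons mult.commute del: power_Suc)
  show ?case
    by (simp add: line_poly_single pderiv_smult pderiv_prod diff_op_linear_form pdiff_single
        line_poly_sum line_poly_pscale *[unfolded One_nat_def] ** smult_sum_right mult_ac)
next
  case (add p q)
  then show ?case by (simp add: line_poly_add pderiv_add diff_op_add_right)
qed

lemma higher_pderiv_line_poly:
  "(pderiv ^^ k) (line_poly t v p) = line_poly t v ((diff_op (linear_form v) ^^ k) p)"
  by (induction k) (simp_all add: pderiv_line_poly)

lemma coeff_line_poly:
  "coeff (line_poly t v p) k = peval ((diff_op (linear_form v) ^^ k) p) t / fact k"
proof -
  have "peval ((diff_op (linear_form v) ^^ k) p) t = poly ((pderiv ^^ k) (line_poly t v p)) 0"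
    using poly_line_poly[of t v _ 0] by (simp add: higher_pderiv_line_poly)
  also have "\<dots> = fact k * coeff (line_poly t v p) k"
    by (simp add: poly_0_coeff_0 coeff_higher_pderiv pochhammer_fact)
  finally show ?thesis by simp
qed

lemma poly_eqI_of_real:
  fixes p q :: "complex poly"
  assumes "infinite S" "\<And>s. s \<in> S \<Longrightarrow> poly p (of_real s) = poly q (of_real s)"
  shows "p = q"
proof (rule ccontr)
  assume "p \<noteq> q"
  then have "finite {z. poly (p - q) z = 0}"
    by (intro poly_roots_finite) simp
  moreover have "complex_of_real ` S \<subseteq> {z. poly (p - q) z = 0}"
    using assms(2) by auto
  ultimately have "finite (complex_of_real ` S)"
    by (rule finite_subset[rotated])
  then show False
    using assms(1) by (simp add: finite_image_iff inj_on_def)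
qed

text \<open>If p vanishes everywhere, so does each partial derivative, being the linear Taylor
  coefficient along a coordinate axis. The value of \<open>mdiff m p\<close> at the origin is a
  nonzero factorial multiple of the coefficient at m, so every coefficient is 0.\<close>

lemma peval_eq_0_iff: "(\<forall>t. peval p t = 0) \<longleftrightarrow> p = 0"
proof
  assume p: "\<forall>t. peval p t = 0"
  have pd: "\<forall>t. peval (pdiff i q) t = 0" if q: "\<forall>t. peval q t = 0" for i and q :: "'a cpoly"
  proof
    fix t :: "real ^ 'a"
    have "line_poly t (axis i 1) q = 0"
      by (rule poly_eqI_of_real[of UNIV]) (use q in \<open>simp_all add: poly_line_poly infinite_UNIV_char_0\<close>)
    then have "peval (diff_op (linear_form (axis i 1)) q) t = 0"
      using coeff_line_poly[of t "axis i 1" q 1] by simp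
    moreover have "pscale (of_real (axis i 1 $ j)) (pdiff j q) =
        (if j = i then pdiff j q else 0)" for j
      by (simp add: axis_def)
    ultimately show "peval (pdiff i q) t = 0"
      by (simp add: diff_op_linear_form)
  qed
  have pd': "\<forall>t. peval ((pdiff i ^^ k) q) t = 0" if "\<forall>t. peval q t = 0"
    for i k and q :: "'a cpoly"
    using that by (induction k) (simp_all add: pd)
  show "p = 0"
  proof (rule poly_mapping_eqI)
    fix m
    interpret comp_fun_commute "\<lambda>i::'a. pdiff i ^^ Poly_Mapping.lookup m i"
      by (rule comp_fun_commute_pdiff)
    have "\<forall>t. peval (Finite_Set.fold (\<lambda>i. pdiff i ^^ Poly_Mapping.lookup m i) p S) t = 0"
      if "finite S" for S
      using that by induction (use p pd' in auto)
    then have "peval (mdiff m p) 0 = 0"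
      by (simp add: mdiff_def)
    moreover have "peval q 0 = Poly_Mapping.lookup q 0" for q :: "'a cpoly"
    proof (induction q rule: cpoly_induct)
      case (single k c)
      have "(\<Prod>i\<in>UNIV. (0::complex) ^ Poly_Mapping.lookup k i) = (if k = 0 then 1 else 0)"
        by (auto simp: prod_zero_iff poly_mapping_eq_iff fun_eq_iff)
      then show ?case by (simp add: peval_single lookup_single when_def)
    qed (simp add: peval_add lookup_add)
    ultimately have "Poly_Mapping.lookup (mdiff m p) 0 = 0"
      by simp
    then show "Poly_Mapping.lookup p m = Poly_Mapping.lookup 0 m"
      by (simp add: lookup_mdiff pochhammer_fact[symmetric])
  qed
qed simp

lemma peval_inject: "peval p = peval q \<longleftrightarrow> p = q"
  using peval_eq_0_iff[of "p - q"] by (auto simp: peval_diff fun_eq_iff)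

section \<open>Polynomial functions\<close>

text \<open>Functions instead of coefficient tables make restriction to a subspace and linear
  substitution easy; the inductive form supports the division argument of
  \<open>polyfun_divide_linear\<close>.\<close>

inductive polyfun :: "(real ^ 'n::finite \<Rightarrow> complex) \<Rightarrow> bool" where
  polyfun_const: "polyfun (\<lambda>_. c)"
| polyfun_coord: "polyfun (\<lambda>t. of_real (t $ i))"
| polyfun_add: "polyfun f \<Longrightarrow> polyfun g \<Longrightarrow> polyfun (\<lambda>t. f t + g t)"
| polyfun_mult: "polyfun f \<Longrightarrow> polyfun g \<Longrightarrow> polyfun (\<lambda>t. f t * g t)"

lemma polyfun_sum: "(\<And>a. a \<in> A \<Longrightarrow> polyfun (f a)) \<Longrightarrow> polyfun (\<lambda>t. \<Sum>a\<in>A. f a t)"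
  by (induction A rule: infinite_finite_induct) (auto intro: polyfun.intros)

lemma polyfun_prod: "(\<And>a. a \<in> A \<Longrightarrow> polyfun (f a)) \<Longrightarrow> polyfun (\<lambda>t. \<Prod>a\<in>A. f a t)"
  by (induction A rule: infinite_finite_induct) (auto intro: polyfun.intros)

lemma polyfun_power: "polyfun f \<Longrightarrow> polyfun (\<lambda>t. f t ^ k)"
  by (induction k) (auto intro: polyfun.intros)

lemma polyfun_peval: "polyfun (peval p)"
  unfolding peval_def
  by (intro polyfun_sum polyfun_prod polyfun_power polyfun.intros)

lemma polyfun_iff_peval: "polyfun f \<longleftrightarrow> (\<exists>p. f = peval p)"
proof
  assume "polyfun f"
  then show "\<exists>p. f = peval p"
  proof induction
    case (polyfun_const c)
    show ?case by (rule exI[of _ "Poly_Mapping.single 0 c"]) (simp add: fun_eq_iff peval_single)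
  next
    case (polyfun_coord i)
    show ?case
      by (rule exI[of _ "linear_form (axis i 1)"])
        (simp add: fun_eq_iff peval_linear_form inner_axis inner_commute[of "axis i 1"])
  next
    case (polyfun_add f g)
    then obtain p q where "f = peval p" "g = peval q" by blast
    then show ?case by (intro exI[of _ "p + q"]) (simp add: fun_eq_iff peval_add)
  next
    case (polyfun_mult f g)
    then obtain p q where "f = peval p" "g = peval q" by blast
    then show ?case by (intro exI[of _ "p * q"]) (simp add: fun_eq_iff peval_mult)
  qed
qed (auto simp: polyfun_peval)

lemma polyfun_scale: "polyfun f \<Longrightarrow> polyfun (\<lambda>t. c * f t)"
  by (intro polyfun.intros)

lemma polyfun_diff: "polyfun f \<Longrightarrow> polyfun g \<Longrightarrow> polyfun (\<lambda>t. f t - g t)"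
  using polyfun_add[OF _ polyfun_scale[of g "-1"]] by simp

lemma polyfun_inner: "polyfun (\<lambda>t. of_real (y \<bullet> t))"
  using polyfun_peval[of "linear_form y"] by (simp add: peval_linear_form[abs_def] fun_eq_iff)

lemma polyfun_compose_linear:
  assumes "polyfun f" "linear A"
  shows "polyfun (\<lambda>t. f (A t))"
  using assms(1)
proof induction
  case (polyfun_coord i)
  have "A t $ i = adjoint A (axis i 1) \<bullet> t" for t
    using adjoint_clauses(2)[OF assms(2), of "axis i 1" t]
    by (simp add: inner_axis inner_commute[of "axis i 1"])
  then show ?case by (simp add: polyfun_inner)
qed (auto intro: polyfun.intros)

lemma cfun_span_polyfun:
  assumes "f \<in> cfun.span S" "\<And>g. g \<in> S \<Longrightarrow> polyfun g"
  shows "polyfun f"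
  using assms(1)
proof (induction rule: cfun.span_induct_alt)
  case base
  show ?case using polyfun_const[of 0] by (simp add: zero_fun_def)
next
  case (step c x y)
  then show ?case
    using polyfun_add[OF polyfun_scale[of x c]] assms(2) by (simp add: plus_fun_def)
qed

text \<open>The point t is compared with its projection to v.t = 0. A coordinate changes by a
  multiple of v.t, and divisibility of the change passes to sums and, by the discrete Leibniz rule,
  to products. For v = 0 the projection is the identity and both sides are 0.\<close>

lemma polyfun_divide_linear:
  assumes "polyfun f"
  shows "\<exists>g. polyfun g \<and> (\<forall>t. f t - f (t - ((v \<bullet> t) / (v \<bullet> v)) *\<^sub>R v) = of_real (v \<bullet> t) * g t)"
  using assms
proof induction
  case (polyfun_const c)
  show ?case by (rule exI[of _ "\<lambda>_. 0"]) (simp add: polyfun.intros)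
next
  case (polyfun_coord i)
  show ?case by (rule exI[of _ "\<lambda>_. of_real (v $ i / (v \<bullet> v))"]) (simp add: polyfun.intros)
next
  case (polyfun_add f1 f2)
  then obtain g1 g2 where g: "polyfun g1" "polyfun g2"
    "\<And>t. f1 t - f1 (t - ((v \<bullet> t) / (v \<bullet> v)) *\<^sub>R v) = of_real (v \<bullet> t) * g1 t"
    "\<And>t. f2 t - f2 (t - ((v \<bullet> t) / (v \<bullet> v)) *\<^sub>R v) = of_real (v \<bullet> t) * g2 t"
    by blast
  show ?case
    by (rule exI[of _ "\<lambda>t. g1 t + g2 t"])
      (use g in \<open>simp add: polyfun.intros distrib_left flip: g(3,4)\<close>)
next
  case (polyfun_mult f1 f2)
  let ?P = "\<lambda>t. t - ((v \<bullet> t) / (v \<bullet> v)) *\<^sub>R v"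
  obtain g1 g2 where g: "polyfun g1" "polyfun g2"
    "\<And>t. f1 t - f1 (?P t) = of_real (v \<bullet> t) * g1 t"
    "\<And>t. f2 t - f2 (?P t) = of_real (v \<bullet> t) * g2 t"
    using polyfun_mult by blast
  have "linear ?P"
    by (rule linearI) (simp_all add: algebra_simps inner_add_right add_divide_distrib)
  then have "polyfun (\<lambda>t. g1 t * f2 t + f1 (?P t) * g2 t)"
    using polyfun_mult g
    by (intro polyfun.intros) (auto intro: polyfun_compose_linear)
  moreover have "f1 t * f2 t - f1 (?P t) * f2 (?P t) =
      of_real (v \<bullet> t) * (g1 t * f2 t + f1 (?P t) * g2 t)" for t
  proof -
    have "f1 t * f2 t - f1 (?P t) * f2 (?P t) =
      (f1 t - f1 (?P t)) * f2 t + f1 (?P t) * (f2 t - f2 (?P t))"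
      by (simp add: algebra_simps)
    then show ?thesis unfolding g by (simp add: algebra_simps)
  qed
  ultimately show ?case by blast
qed

section \<open>Linear factors on orthogonal complements\<close>

lemma orthogonal_comp_insert_span:
  "(span (insert x U))\<^sup>\<bottom> = {t \<in> U\<^sup>\<bottom>. x \<bullet> t = 0}" (is "?L = ?R")
proof
  show "?L \<subseteq> ?R"
    by (auto simp: orthogonal_comp_def orthogonal_def intro: span_base)
  show "?R \<subseteq> ?L"
  proof
    fix t assume t: "t \<in> ?R"
    have "y \<bullet> t = 0" if "y \<in> span (insert x U)" for y
      using that
    proof (induction rule: span_induct)
      case base
      show ?case by (auto simp: subspace_def inner_add_left)
    qed (use t in \<open>auto simp: orthogonal_comp_def orthogonal_def\<close>)
    then show "t \<in> ?L" by (simp add: orthogonal_comp_def orthogonal_def)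
  qed
qed

lemma component_orthogonal:
  fixes x :: "'a::euclidean_space"
  assumes "subspace U" "x \<notin> U"
  obtains v where "v \<in> U\<^sup>\<bottom>" "v \<noteq> 0" "\<And>t. t \<in> U\<^sup>\<bottom> \<Longrightarrow> x \<bullet> t = v \<bullet> t" "x \<bullet> v \<noteq> 0"
proof -
  obtain u v where uv: "u \<in> U" "v \<in> U\<^sup>\<bottom>" "x = u + v"
    using subspace_sum_orthogonal_comp[OF assms(1)] by (metis UNIV_I set_plus_elim)
  then have *: "x \<bullet> t = v \<bullet> t" if "t \<in> U\<^sup>\<bottom>" for t
    using that by (simp add: orthogonal_comp_def orthogonal_def inner_add_left)
  moreover have "v \<noteq> 0"
    using uv assms by auto
  ultimately show ?thesis
    using that uv(2) by (metis inner_eq_zero_iff)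
qed

text \<open>The factor theorem inside \<open>U\<^sup>\<bottom>\<close>: projecting t along the
  component v of x stays in the complement and reaches x.t = 0, where f vanishes, so the quotient
  from \<open>polyfun_divide_linear\<close> is the cofactor.\<close>

lemma polyfun_divide:
  assumes "polyfun f" "subspace U" "x \<notin> U"
    and zero: "\<And>t. t \<in> (span (insert x U))\<^sup>\<bottom> \<Longrightarrow> f t = 0"
  shows "\<exists>g. polyfun g \<and> (\<forall>t\<in>U\<^sup>\<bottom>. f t = of_real (x \<bullet> t) * g t)"
proof -
  obtain v where v: "v \<in> U\<^sup>\<bottom>" "v \<noteq> 0" "\<And>t. t \<in> U\<^sup>\<bottom> \<Longrightarrow> x \<bullet> t = v \<bullet> t"
    using component_orthogonal[OF assms(2,3)] by blast
  obtain g where g: "polyfun g"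
    "\<And>t. f t - f (t - ((v \<bullet> t) / (v \<bullet> v)) *\<^sub>R v) = of_real (v \<bullet> t) * g t"
    using polyfun_divide_linear[OF assms(1), of v] by blast
  have "f t = of_real (x \<bullet> t) * g t" if t: "t \<in> U\<^sup>\<bottom>" for t
  proof -
    let ?t = "t - ((v \<bullet> t) / (v \<bullet> v)) *\<^sub>R v"
    have t': "?t \<in> U\<^sup>\<bottom>"
      using t v(1) by (simp add: subspace_orthogonal_comp subspace_diff subspace_scale)
    have "x \<bullet> ?t = 0"
      unfolding v(3)[OF t'] using v(2) by (simp add: inner_diff_right)
    then have "f ?t = 0"
      using t' by (intro zero) (simp add: orthogonal_comp_insert_span)
    then show ?thesis
      using g(2)[of t] v(3)[OF t] by simp
  qed
  then show ?thesis
    using g(1) by blast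
qed

text \<open>On the line t + s w the form given by x has a single root in s. For all other s the
  polynomial q vanishes, hence it vanishes on the whole line and in particular at s = 0.\<close>

lemma polyfun_cancel_linear:
  assumes "polyfun q" "subspace V" "w \<in> V" "x \<bullet> w \<noteq> 0"
    and zero: "\<And>t. t \<in> V \<Longrightarrow> of_real (x \<bullet> t) * q t = 0" and t: "t \<in> V"
  shows "q t = 0"
proof -
  obtain p where p: "q = peval p"
    using assms(1) polyfun_iff_peval by blast
  have "line_poly t w p = 0"
  proof (rule poly_eqI_of_real[of "UNIV - {- (x \<bullet> t) / (x \<bullet> w)}"])
    show "infinite (UNIV - {- (x \<bullet> t) / (x \<bullet> w)})"
      by (simp add: infinite_UNIV_char_0)
    fix s assume "s \<in> UNIV - {- (x \<bullet> t) / (x \<bullet> w)}"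
    then have "x \<bullet> (t + s *\<^sub>R w) \<noteq> 0"
      using assms(4) by (auto simp: inner_add_right field_simps)
    moreover have "t + s *\<^sub>R w \<in> V"
      using assms(2,3) t by (simp add: subspace_add subspace_scale)
    ultimately have "q (t + s *\<^sub>R w) = 0"
      using zero by fastforce
    then show "poly (line_poly t w p) (of_real s) = poly 0 (of_real s)"
      by (simp add: poly_line_poly p)
  qed
  then show ?thesis
    using poly_line_poly[of t w p 0] by (simp add: p)
qed

text \<open>A Vandermonde argument by induction: dilating by 2 and subtracting 2^N times the
  original cancels the top component and multiplies the d-th one by 2^d - 2^N, which is nonzero for
  d < N.\<close>

lemma cfun_subspace_homogeneous_components:
  assumes S: "cfun.subspace S"
    and "\<And>r::real. (\<lambda>t. \<Sum>d<N. of_real r ^ d * g d t) \<in> S" "d < N"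
  shows "g d \<in> S"
  using assms(2,3)
proof (induction N arbitrary: g d)
  case (Suc N)
  let ?G = "\<lambda>g N (r::real) t. \<Sum>d<N. of_real r ^ d * (g d t :: complex)"
  let ?h = "\<lambda>d t. (2 ^ d - 2 ^ N) * g d t"
  have "?G ?h N r \<in> S" for r
  proof -
    have "?G ?h N r = ?G g (Suc N) (2 * r) - (\<lambda>t. 2 ^ N * ?G g (Suc N) r t)"
      by (simp add: fun_eq_iff power_mult_distrib algebra_simps sum_subtractf sum_distrib_left)
    moreover have "(\<lambda>t. 2 ^ N * ?G g (Suc N) r t) \<in> S"
      using cfun.subspace_scale[OF S Suc.prems(1)[of r], of "2 ^ N"] by simp
    ultimately show ?thesis
      using cfun.subspace_diff[OF S Suc.prems(1)[of "2 * r"]] by simp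
  qed
  then have h: "?h d \<in> S" if "d < N" for d
    using Suc.IH[of ?h d] that by blast
  have low: "g d \<in> S" if "d < N" for d
  proof -
    have "(2::complex) ^ d \<noteq> 2 ^ N"
    proof
      assume "(2::complex) ^ d = 2 ^ N"
      then have "of_nat (2 ^ d) = (of_nat (2 ^ N) :: complex)" by simp
      then have "(2::nat) ^ d = 2 ^ N" unfolding of_nat_eq_iff .
      then show False using that by simp
    qed
    then have "g d = (\<lambda>t. inverse (2 ^ d - 2 ^ N) * ?h d t)"
      by (auto simp: fun_eq_iff)
    then show ?thesis
      using cfun.subspace_scale[OF S h[OF that], of "inverse (2 ^ d - 2 ^ N)"] by metis
  qed
  show ?case
  proof (cases "d = N")
    case True
    have "(\<Sum>d<N. g d) \<in> S"
      by (rule cfun.subspace_sum[OF S]) (use low in auto)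
    moreover have "(\<lambda>t. \<Sum>d<Suc N. g d t) \<in> S"
      using Suc.prems(1)[of 1] by simp
    moreover have "sum g A t = (\<Sum>d\<in>A. g d t)" for A t
      by (induction A rule: infinite_finite_induct) auto
    then have "g N = (\<lambda>t. \<Sum>d<Suc N. g d t) - (\<Sum>d<N. g d)"
      by (simp add: fun_eq_iff)
    ultimately show ?thesis
      using cfun.subspace_diff[OF S] True by metis
  next
    case False
    then show ?thesis using low Suc.prems(2) by simp
  qed
qed simp

section \<open>Degree along a direction\<close>

text \<open>For a polynomial f and v in V this is D_v^k f = 0 on V, phrased through lines so that
  only values on V matter. The bound is strict: k = 0 forces f to vanish on V.\<close>

definition deg_below :: "(real ^ 'n) set \<Rightarrow> real ^ 'n \<Rightarrow> nat \<Rightarrow> (real ^ 'n \<Rightarrow> complex) \<Rightarrow> bool" where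
  "deg_below V v k f \<longleftrightarrow> (\<forall>t\<in>V. \<exists>P. (\<forall>i\<ge>k. coeff P i = 0) \<and>
     (\<forall>s::real. f (t + s *\<^sub>R v) = poly P (of_real s)))"

lemma deg_below_mono: "deg_below V v k f \<Longrightarrow> k \<le> l \<Longrightarrow> W \<subseteq> V \<Longrightarrow> deg_below W v l f"
  unfolding deg_below_def by (meson order_trans subsetD)

lemma deg_below_add:
  assumes "deg_below V v k f" "deg_below V v k g"
  shows "deg_below V v k (\<lambda>t. f t + g t)"
  unfolding deg_below_def
proof
  fix t assume "t \<in> V"
  then obtain P Q where "\<forall>i\<ge>k. coeff P i = 0" "\<forall>s::real. f (t + s *\<^sub>R v) = poly P (of_real s)"
    "\<forall>i\<ge>k. coeff Q i = 0" "\<forall>s::real. g (t + s *\<^sub>R v) = poly Q (of_real s)"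
    using assms unfolding deg_below_def by meson
  then show "\<exists>P. (\<forall>i\<ge>k. coeff P i = 0) \<and>
      (\<forall>s::real. f (t + s *\<^sub>R v) + g (t + s *\<^sub>R v) = poly P (of_real s))"
    by (intro exI[of _ "P + Q"]) auto
qed

lemma deg_below_scale:
  assumes "deg_below V v k f"
  shows "deg_below V v k (\<lambda>t. c * f t)"
  unfolding deg_below_def
proof
  fix t assume "t \<in> V"
  then obtain P where "\<forall>i\<ge>k. coeff P i = 0" "\<forall>s::real. f (t + s *\<^sub>R v) = poly P (of_real s)"
    using assms unfolding deg_below_def by meson
  then show "\<exists>P. (\<forall>i\<ge>k. coeff P i = 0) \<and>
      (\<forall>s::real. c * f (t + s *\<^sub>R v) = poly P (of_real s))"
    by (intro exI[of _ "smult c P"]) auto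
qed

lemma deg_below_zero: "deg_below V v k (\<lambda>_. 0)"
  unfolding deg_below_def by (auto intro!: exI[of _ 0])

lemma deg_below_diff:
  "deg_below V v k f \<Longrightarrow> deg_below V v k g \<Longrightarrow> deg_below V v k (\<lambda>t. f t - g t)"
  using deg_below_add[OF _ deg_below_scale[of V v k g "-1"]] by simp

lemma subspace_deg_below: "cfun.subspace {f. deg_below V v k f}"
  unfolding cfun.subspace_def
  using deg_below_zero deg_below_add deg_below_scale by (auto simp: zero_fun_def plus_fun_def)

lemma deg_below_cong:
  assumes "subspace V" "v \<in> V" "\<And>t. t \<in> V \<Longrightarrow> f t = g t"
  shows "deg_below V v k f \<longleftrightarrow> deg_below V v k g"
proof -
  have "f (t + s *\<^sub>R v) = g (t + s *\<^sub>R v)" if "t \<in> V" for t s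
    using assms that by (simp add: subspace_add subspace_scale)
  then show ?thesis unfolding deg_below_def by simp
qed

lemma deg_below_0D: "deg_below V v 0 f \<Longrightarrow> t \<in> V \<Longrightarrow> f t = 0"
proof -
  assume "deg_below V v 0 f" "t \<in> V"
  then obtain P where P: "\<forall>i. coeff P i = 0" "\<forall>s::real. f (t + s *\<^sub>R v) = poly P (of_real s)"
    unfolding deg_below_def by fastforce
  then have "P = 0" by (simp add: poly_eq_iff)
  then show "f t = 0" using P(2)[rule_format, of 0] by simp
qed

lemma deg_below_scaleR:
  assumes "deg_below V v k f"
  shows "deg_below V (c *\<^sub>R v) k f"
  unfolding deg_below_def
proof
  fix t assume "t \<in> V"
  then obtain P where P: "\<forall>i\<ge>k. coeff P i = 0" "\<forall>s::real. f (t + s *\<^sub>R v) = poly P (of_real s)"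
    using assms unfolding deg_below_def by meson
  have "coeff (pcompose P [:0, of_real c:]) i = 0" if "i \<ge> k" for i
    using P(1) that coeff_pcompose_linear[of P "complex_of_real c" i] by simp
  moreover have "f (t + s *\<^sub>R c *\<^sub>R v) = poly (pcompose P [:0, of_real c:]) (of_real s)" for s
    using P(2)[rule_format, of "s * c"] by (simp add: poly_pcompose mult.commute)
  ultimately show "\<exists>P. (\<forall>i\<ge>k. coeff P i = 0) \<and>
      (\<forall>s::real. f (t + s *\<^sub>R c *\<^sub>R v) = poly P (of_real s))"
    by blast
qed

lemma deg_below_dilate:
  assumes "deg_below V v k f" "subspace V"
  shows "deg_below V v k (\<lambda>t. f (r *\<^sub>R t))"
  unfolding deg_below_def
proof
  fix t assume "t \<in> V"
  then have "r *\<^sub>R t \<in> V"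
    using assms(2) by (simp add: subspace_scale)
  then show "\<exists>P. (\<forall>i\<ge>k. coeff P i = 0) \<and>
      (\<forall>s::real. f (r *\<^sub>R (t + s *\<^sub>R v)) = poly P (of_real s))"
    using deg_below_scaleR[OF assms(1), of r] unfolding deg_below_def
    by (auto simp: scaleR_add_right mult.commute)
qed

lemma deg_below_peval:
  "deg_below V v k (peval p) \<longleftrightarrow>
     (\<forall>t\<in>V. \<forall>i\<ge>k. peval ((diff_op (linear_form v) ^^ i) p) t = 0)"
proof -
  have "(\<exists>P. (\<forall>i\<ge>k. coeff P i = 0) \<and> (\<forall>s::real. peval p (t + s *\<^sub>R v) = poly P (of_real s)))
      \<longleftrightarrow> (\<forall>i\<ge>k. coeff (line_poly t v p) i = 0)" (is "?A \<longleftrightarrow> ?B") for t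
  proof
    assume ?A
    then obtain P where P: "\<forall>i\<ge>k. coeff P i = 0"
      "\<forall>s::real. peval p (t + s *\<^sub>R v) = poly P (of_real s)" by blast
    have "line_poly t v p = P"
      by (rule poly_eqI_of_real[of UNIV]) (simp_all add: poly_line_poly P infinite_UNIV_char_0)
    then show ?B using P by simp
  next
    assume ?B
    then show ?A by (intro exI[of _ "line_poly t v p"]) (simp add: poly_line_poly)
  qed
  then show ?thesis
    unfolding deg_below_def by (simp add: coeff_line_poly)
qed

text \<open>All higher powers kill p as soon as the k-th does, so the bounds on all lines collapse
  to one operator equation. This is the bridge to the ideal.\<close>

lemma deg_below_UNIV_peval:
  "deg_below UNIV v k (peval p) \<longleftrightarrow> diff_op (linear_form v ^ k) p = 0"
proof -
  have z: "(diff_op q ^^ j) 0 = 0" for q j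
    by (induction j) simp_all
  have "(diff_op q ^^ i) p = 0" if "(diff_op q ^^ k) p = 0" "i \<ge> k" for q i
  proof -
    have "(diff_op q ^^ i) p = (diff_op q ^^ (i - k)) ((diff_op q ^^ k) p)"
      using that(2) by (simp flip: comp_apply[of "_ ^^ _"] funpow_add)
    then show ?thesis using that(1) z by simp
  qed
  then have "diff_op (linear_form v ^ k) p = 0 \<longleftrightarrow>
      (\<forall>i\<ge>k. (diff_op (linear_form v) ^^ i) p = 0)"
    by (auto simp: diff_op_power)
  then show ?thesis
    unfolding deg_below_peval peval_eq_0_iff[symmetric] by auto
qed

lemma deg_below_mult_linear:
  assumes "deg_below V v k f"
  shows "deg_below V v (if x \<bullet> v = 0 then k else Suc k) (\<lambda>t. of_real (x \<bullet> t) * f t)"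
  unfolding deg_below_def
proof
  fix t assume "t \<in> V"
  then obtain P where P: "\<forall>i\<ge>k. coeff P i = 0" "\<forall>s::real. f (t + s *\<^sub>R v) = poly P (of_real s)"
    using assms unfolding deg_below_def by meson
  let ?Q = "[:of_real (x \<bullet> t), of_real (x \<bullet> v):] * P"
  have "\<forall>i\<ge>(if x \<bullet> v = 0 then k else Suc k). coeff ?Q i = 0"
    using P(1) by (auto simp: coeff_pCons split: nat.splits)
  moreover have "of_real (x \<bullet> (t + s *\<^sub>R v)) * f (t + s *\<^sub>R v) = poly ?Q (of_real s)" for s
    using P(2) by (simp add: inner_add_right algebra_simps)
  ultimately show "\<exists>P. (\<forall>i\<ge>(if x \<bullet> v = 0 then k else Suc k). coeff P i = 0) \<and>
      (\<forall>s::real. of_real (x \<bullet> (t + s *\<^sub>R v)) * f (t + s *\<^sub>R v) = poly P (of_real s))"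
    by blast
qed

text \<open>If x.v = 0, the factor is constant on each line and is cancelled in every Taylor
  coefficient, also where x.t = 0 thanks to \<open>polyfun_cancel_linear\<close>. Otherwise the
  product has degree exactly one more, its leading coefficient being multiplied by x.v.\<close>

lemma deg_below_cancel_linear:
  assumes "polyfun g" "subspace V" "w \<in> V" "x \<bullet> w \<noteq> 0"
    and deg: "deg_below V v (if x \<bullet> v = 0 then k else Suc k) (\<lambda>t. of_real (x \<bullet> t) * g t)"
  shows "deg_below V v k g"
proof -
  obtain p where p: "g = peval p"
    using assms(1) polyfun_iff_peval by blast
  let ?k = "if x \<bullet> v = 0 then k else Suc k"
  have Q: "coeff ([:of_real (x \<bullet> t), of_real (x \<bullet> v):] * line_poly t v p) i = 0"
    if "t \<in> V" "i \<ge> ?k" for t i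
  proof -
    obtain Q where Q: "\<forall>i\<ge>?k. coeff Q i = 0"
      "\<forall>s::real. of_real (x \<bullet> (t + s *\<^sub>R v)) * g (t + s *\<^sub>R v) = poly Q (of_real s)"
      using deg \<open>t \<in> V\<close> unfolding deg_below_def by meson
    have "[:of_real (x \<bullet> t), of_real (x \<bullet> v):] * line_poly t v p = Q"
    proof (rule poly_eqI_of_real[of UNIV])
      fix s :: real
      have "poly ([:of_real (x \<bullet> t), of_real (x \<bullet> v):] * line_poly t v p) (of_real s) =
        of_real (x \<bullet> (t + s *\<^sub>R v)) * g (t + s *\<^sub>R v)"
        by (simp add: p poly_line_poly inner_add_right algebra_simps)
      then show "poly ([:of_real (x \<bullet> t), of_real (x \<bullet> v):] * line_poly t v p) (of_real s) =
          poly Q (of_real s)"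
        using Q(2) by simp
    qed (simp add: infinite_UNIV_char_0)
    then show ?thesis using Q(1) that by simp
  qed
  have "coeff (line_poly t v p) i = 0" if t: "t \<in> V" and i: "i \<ge> k" for t i
  proof (cases "x \<bullet> v = 0")
    case True
    have "peval ((diff_op (linear_form v) ^^ i) p) t = 0"
    proof (rule polyfun_cancel_linear[OF polyfun_peval assms(2-4) _ t])
      fix t assume "t \<in> V"
      then show "of_real (x \<bullet> t) * peval ((diff_op (linear_form v) ^^ i) p) t = 0"
        using Q[of t i] i True by (simp add: coeff_line_poly)
    qed
    then show ?thesis by (simp add: coeff_line_poly)
  next
    case False
    show ?thesis
    proof (rule ccontr)
      assume ne: "coeff (line_poly t v p) i \<noteq> 0"
      let ?n = "degree (line_poly t v p)"
      have "k \<le> ?n" "line_poly t v p \<noteq> 0"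
        using ne i le_degree[OF ne] by auto
      then have "coeff ([:of_real (x \<bullet> t), of_real (x \<bullet> v):] * line_poly t v p) (Suc ?n) = 0"
        using False by (intro Q[OF t]) simp
      then have "coeff (line_poly t v p) ?n = 0"
        using False by (simp add: coeff_eq_0)
      then show False using \<open>line_poly t v p \<noteq> 0\<close> by simp
    qed
  qed
  then show ?thesis
    unfolding p deg_below_peval by (simp add: coeff_line_poly)
qed

section \<open>The central case, relative to a subspace\<close>

text \<open>Contracting the elements of a subspace \<open>U\<close> amounts to restricting polynomials to the
  orthogonal complement of \<open>U\<close>, so all spaces are considered relative to \<open>U\<close>.\<close>

definition facet_normal :: "(real ^ 'n) set \<Rightarrow> (real ^ 'n) multiset \<Rightarrow> real ^ 'n \<Rightarrow> bool" where
  "facet_normal U X v \<longleftrightarrow> v \<noteq> 0 \<and> span (U \<union> {x \<in> set_mset X. v \<bullet> x = 0}) = {x. v \<bullet> x = 0}"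

definition off_count :: "(real ^ 'n) multiset \<Rightarrow> real ^ 'n \<Rightarrow> nat" where
  "off_count X v = size (filter_mset (\<lambda>x. v \<bullet> x \<noteq> 0) X)"

text \<open>The case \<open>\<delta> = 0\<close> is central and \<open>\<delta> = 1\<close> is internal.\<close>

definition in_kernel ::
  "(real ^ 'n) set \<Rightarrow> (real ^ 'n) multiset \<Rightarrow> nat \<Rightarrow> (real ^ 'n \<Rightarrow> complex) \<Rightarrow> bool" where
  "in_kernel U X \<delta> f \<longleftrightarrow>
     (\<forall>v. facet_normal U X v \<longrightarrow> deg_below (U\<^sup>\<bottom>) v (off_count X v - \<delta>) f)"

text \<open>Restricted to \<open>U\<^sup>\<bottom>\<close>, this is the central space of the
  contraction by U: what remains after removing Y has to span only modulo U.\<close>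

definition P_rel :: "(real ^ 'n) set \<Rightarrow> (real ^ 'n) multiset \<Rightarrow> (real ^ 'n::finite \<Rightarrow> complex) set" where
  "P_rel U X = cfun.span {(\<lambda>t. \<Prod>y\<in>#Y. of_real (y \<bullet> t)) | Y.
     Y \<subseteq># X \<and> span (U \<union> set_mset (X - Y)) = UNIV}"

lemma off_count_empty [simp]: "off_count {#} v = 0"
  by (simp add: off_count_def)

lemma off_count_add_mset [simp]:
  "off_count (add_mset x X) v = (if v \<bullet> x = 0 then off_count X v else Suc (off_count X v))"
  by (simp add: off_count_def)

lemma off_count_union [simp]: "off_count (X + Y) v = off_count X v + off_count Y v"
  by (simp add: off_count_def)

lemma off_count_eq_0_iff: "off_count X v = 0 \<longleftrightarrow> (\<forall>x\<in>#X. v \<bullet> x = 0)"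
  by (induction X) auto

lemma facet_normal_orthogonal: "facet_normal U X v \<Longrightarrow> v \<in> U\<^sup>\<bottom>"
proof -
  assume "facet_normal U X v"
  then have "span (U \<union> {x \<in> set_mset X. v \<bullet> x = 0}) = {x. v \<bullet> x = 0}"
    by (simp add: facet_normal_def)
  moreover have "U \<subseteq> span (U \<union> {x \<in> set_mset X. v \<bullet> x = 0})"
    by (auto intro: span_base)
  ultimately have "v \<bullet> u = 0" if "u \<in> U" for u
    using that by blast
  then show ?thesis
    by (simp add: orthogonal_comp_def orthogonal_def inner_commute)
qed

lemma facet_normal_add_mset:
  assumes "facet_normal U X v"
  shows "facet_normal U (add_mset x X) v"
proof -
  have v: "v \<noteq> 0" "span (U \<union> {x \<in> set_mset X. v \<bullet> x = 0}) = {x. v \<bullet> x = 0}"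
    using assms by (auto simp: facet_normal_def)
  have U: "U \<subseteq> {x. v \<bullet> x = 0}"
    using facet_normal_orthogonal[OF assms]
    by (auto simp: orthogonal_comp_def orthogonal_def inner_commute)
  have "span (U \<union> {y \<in> set_mset (add_mset x X). v \<bullet> y = 0}) \<subseteq> {x. v \<bullet> x = 0}"
    by (rule span_minimal) (use U in \<open>auto simp: subspace_hyperplane\<close>)
  moreover have "span (U \<union> {x \<in> set_mset X. v \<bullet> x = 0}) \<subseteq>
      span (U \<union> {y \<in> set_mset (add_mset x X). v \<bullet> y = 0})"
    by (rule span_mono) auto
  ultimately show ?thesis
    using v unfolding facet_normal_def by auto
qed

lemma span_Un_span: "span (span A \<union> B) = span (A \<union> B)"
proof
  show "span (span A \<union> B) \<subseteq> span (A \<union> B)"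
    by (rule span_minimal) (auto intro: span_base subsetD[OF span_mono[of A]])
  show "span (A \<union> B) \<subseteq> span (span A \<union> B)"
    by (rule span_mono) (auto intro: span_base)
qed

text \<open>A hyperplane of the contraction contains x, so x does not contribute to its
  multiplicity. Hence the kernel conditions pass to the contraction with unchanged
  exponents.\<close>

lemma facet_normal_contract:
  assumes "facet_normal (span (insert x U)) X v"
  shows "facet_normal U (add_mset x X) v" "v \<bullet> x = 0"
proof -
  show x: "v \<bullet> x = 0"
    using facet_normal_orthogonal[OF assms]
    by (simp add: orthogonal_comp_insert_span inner_commute)
  let ?A = "{y \<in> set_mset X. v \<bullet> y = 0}"
  have "span (span (insert x U) \<union> ?A) = span (insert x U \<union> ?A)"
    by (rule span_Un_span)
  moreover have "insert x U \<union> ?A = U \<union> {y \<in> set_mset (add_mset x X). v \<bullet> y = 0}"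
    using x by auto
  ultimately show "facet_normal U (add_mset x X) v"
    using assms unfolding facet_normal_def by simp
qed

lemma orthogonal_span_UNIV:
  fixes v :: "'a::real_inner"
  assumes "span S = UNIV" "\<And>x. x \<in> S \<Longrightarrow> v \<bullet> x = 0"
  shows "v = 0"
proof -
  have "span S \<subseteq> {x. v \<bullet> x = 0}"
    by (rule span_minimal) (use assms in \<open>auto simp: subspace_hyperplane\<close>)
  then have "v \<in> {x. v \<bullet> x = 0}" using assms(1) by blast
  then show ?thesis by simp
qed

text \<open>Since adding x restores the whole space, the span of U and X has codimension one and v
  is its normal. No element of X lies off this hyperplane, so the exponent is 0 and the central
  kernel of the deletion is zero on \<open>U\<^sup>\<bottom>\<close>.\<close>

lemma facet_normal_coloop:
  assumes "span (U \<union> set_mset (add_mset x X)) = UNIV" "span (U \<union> set_mset X) \<noteq> UNIV"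
  obtains v where "facet_normal U X v" "off_count X v = 0" "v \<bullet> x \<noteq> 0"
proof -
  obtain v where v: "v \<noteq> 0" "\<And>y. y \<in> span (U \<union> set_mset X) \<Longrightarrow> v \<bullet> y = 0"
    using span_not_UNIV_orthogonal[OF assms(2)] by blast
  have X: "v \<bullet> y = 0" if "y \<in># X" for y
    using that by (intro v(2)) (auto intro: span_base)
  have x: "v \<bullet> x \<noteq> 0"
  proof
    assume "v \<bullet> x = 0"
    then have "v = 0"
      by (intro orthogonal_span_UNIV[OF assms(1)]) (use v(2) in \<open>auto intro: span_base\<close>)
    then show False using v(1) by simp
  qed
  have "y \<in> span (U \<union> set_mset X)" if y: "v \<bullet> y = 0" for y
  proof -
    have "y \<in> span (insert x (U \<union> set_mset X))"
      using assms(1) by simp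
    then obtain k where k: "y - k *\<^sub>R x \<in> span (U \<union> set_mset X)"
      unfolding span_insert by blast
    then have "v \<bullet> (y - k *\<^sub>R x) = 0"
      by (rule v(2))
    then have "k = 0" using x y by (simp add: inner_diff_right)
    then show ?thesis using k by simp
  qed
  then have "span (U \<union> set_mset X) = {y. v \<bullet> y = 0}"
    using v(2) by auto
  moreover have "{y \<in> set_mset X. v \<bullet> y = 0} = set_mset X"
    using X by auto
  ultimately have "facet_normal U X v"
    using v(1) by (simp add: facet_normal_def)
  then show ?thesis
    using that x X by (simp add: off_count_eq_0_iff)
qed

lemma off_count_pos:
  assumes "span (U \<union> set_mset X) = UNIV" "v \<in> U\<^sup>\<bottom>" "v \<noteq> 0"
  shows "off_count X v > 0"
proof (rule ccontr)
  assume "\<not> ?thesis"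
  then have "v = 0"
    using assms(2) by (intro orthogonal_span_UNIV[OF assms(1)])
      (auto simp: off_count_eq_0_iff orthogonal_comp_def orthogonal_def inner_commute)
  then show False using assms(3) by simp
qed

lemma deg_below_prod:
  "deg_below V v (Suc (off_count Y v)) (\<lambda>t. \<Prod>y\<in>#Y. of_real (y \<bullet> t))"
proof (induction Y)
  case empty
  show ?case unfolding deg_below_def by (auto intro!: exI[of _ 1] simp: coeff_eq_0)
next
  case (add y Y)
  show ?case
    using deg_below_mult_linear[OF add, of y] by (simp add: inner_commute split: if_splits)
qed

text \<open>What remains after removing Y still spans, so it contains an element off the hyperplane
  orthogonal to v. The product over Y therefore misses at least one of the factors that raise the
  degree along v.\<close>

lemma P_rel_deg_below:
  assumes "f \<in> P_rel U X" "v \<in> U\<^sup>\<bottom>" "v \<noteq> 0"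
  shows "deg_below V v (off_count X v) f"
proof -
  have "P_rel U X \<subseteq> {f. deg_below V v (off_count X v) f}"
    unfolding P_rel_def
  proof (rule cfun.span_minimal[OF _ subspace_deg_below], safe)
    fix Y assume Y: "Y \<subseteq># X" "span (U \<union> set_mset (X - Y)) = UNIV"
    have "off_count X v = off_count Y v + off_count (X - Y) v"
      using Y(1) by (metis off_count_union subset_mset.add_diff_inverse)
    moreover have "off_count (X - Y) v > 0"
      using Y(2) assms(2,3) by (rule off_count_pos)
    ultimately show "deg_below V v (off_count X v) (\<lambda>t. \<Prod>y\<in>#Y. complex_of_real (y \<bullet> t))"
      by (intro deg_below_mono[OF deg_below_prod]) auto
  qed
  then show ?thesis using assms(1) by blast
qed

lemma P_rel_polyfun: "f \<in> P_rel U X \<Longrightarrow> polyfun f"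
  unfolding P_rel_def
proof (erule cfun_span_polyfun, safe)
  fix Y
  show "polyfun (\<lambda>t. \<Prod>y\<in>#Y. complex_of_real (y \<bullet> t))"
    by (induction Y) (auto intro: polyfun.intros polyfun_inner)
qed

lemma P_rel_0: "0 \<in> P_rel U X"
  unfolding P_rel_def by (rule cfun.span_zero)

lemma P_rel_mono:
  assumes "\<And>Y. Y \<subseteq># X \<Longrightarrow> span (U \<union> set_mset (X - Y)) = UNIV \<Longrightarrow>
    Y \<subseteq># X' \<and> span (U' \<union> set_mset (X' - Y)) = UNIV"
  shows "P_rel U X \<subseteq> P_rel U' X'"
  unfolding P_rel_def by (rule cfun.span_mono) (use assms in blast)

lemma add_mset_diff: "Y \<subseteq># X \<Longrightarrow> add_mset x X - Y = add_mset x (X - Y)"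
  by (metis add_mset_add_single multiset_diff_union_assoc union_commute)

lemma P_rel_add_mset: "P_rel U X \<subseteq> P_rel U (add_mset x X)"
proof (rule P_rel_mono)
  fix Y assume Y: "Y \<subseteq># X" "span (U \<union> set_mset (X - Y)) = UNIV"
  have "span (U \<union> set_mset (X - Y)) \<subseteq> span (U \<union> set_mset (add_mset x X - Y))"
    unfolding add_mset_diff[OF Y(1)] by (rule span_mono) auto
  then show "Y \<subseteq># add_mset x X \<and> span (U \<union> set_mset (add_mset x X - Y)) = UNIV"
    using Y by (auto simp: subseteq_mset_def le_SucI)
qed

text \<open>A product admissible for the contraction does not use the contracted copy of x, so x
  remains available to supply the missing direction of the span.\<close>

lemma P_rel_contract: "P_rel (span (insert x U)) X \<subseteq> P_rel U (add_mset x X)"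
proof (rule P_rel_mono)
  fix Y assume Y: "Y \<subseteq># X" "span (span (insert x U) \<union> set_mset (X - Y)) = UNIV"
  have "span (span (insert x U) \<union> set_mset (X - Y)) = span (insert x U \<union> set_mset (X - Y))"
    by (rule span_Un_span)
  also have "insert x U \<union> set_mset (X - Y) = U \<union> set_mset (add_mset x X - Y)"
    unfolding add_mset_diff[OF Y(1)] by auto
  finally show "Y \<subseteq># add_mset x X \<and> span (U \<union> set_mset (add_mset x X - Y)) = UNIV"
    using Y by (auto simp: subseteq_mset_def le_SucI)
qed

lemma P_rel_mult:
  assumes "f \<in> P_rel U X"
  shows "(\<lambda>t. of_real (x \<bullet> t) * f t) \<in> P_rel U (add_mset x X)"
  using assms unfolding P_rel_def
proof (induction rule: cfun.span_induct_alt)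
  case base
  show ?case
    using cfun.span_zero by (simp add: zero_fun_def)
next
  case (step c g h)
  then obtain Y where Y: "g = (\<lambda>t. \<Prod>y\<in>#Y. of_real (y \<bullet> t))"
    "Y \<subseteq># X" "span (U \<union> set_mset (X - Y)) = UNIV" by blast
  let ?S = "cfun.span {(\<lambda>t. \<Prod>y\<in>#Y. complex_of_real (y \<bullet> t)) | Y.
     Y \<subseteq># add_mset x X \<and> span (U \<union> set_mset (add_mset x X - Y)) = UNIV}"
  have "(\<lambda>t. \<Prod>y\<in>#add_mset x Y. complex_of_real (y \<bullet> t)) \<in> ?S"
    by (rule cfun.span_base) (use Y in \<open>intro CollectI exI[of _ "add_mset x Y"], simp\<close>)
  then have "(\<lambda>t. c * (\<Prod>y\<in>#add_mset x Y. complex_of_real (y \<bullet> t))) \<in> ?S"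
    by (rule cfun.span_scale)
  then have "(\<lambda>t. c * (\<Prod>y\<in>#add_mset x Y. complex_of_real (y \<bullet> t))) +
      (\<lambda>t. of_real (x \<bullet> t) * h t) \<in> ?S"
    using step by (intro cfun.span_add)
  then show ?case
    by (simp add: Y(1) plus_fun_def algebra_simps)
qed

section \<open>Kernel conditions under contraction and deletion\<close>

lemma in_kernel_diff:
  "in_kernel U X \<delta> f \<Longrightarrow> in_kernel U X \<delta> g \<Longrightarrow> in_kernel U X \<delta> (\<lambda>t. f t - g t)"
  by (simp add: in_kernel_def deg_below_diff)

lemma in_kernel_cong:
  assumes "\<And>t. t \<in> U\<^sup>\<bottom> \<Longrightarrow> f t = g t"
  shows "in_kernel U X \<delta> f \<longleftrightarrow> in_kernel U X \<delta> g"
proof -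
  have "deg_below (U\<^sup>\<bottom>) v k f \<longleftrightarrow> deg_below (U\<^sup>\<bottom>) v k g" if "facet_normal U X v" for v k
    using assms that
    by (intro deg_below_cong facet_normal_orthogonal subspace_orthogonal_comp)
  then show ?thesis unfolding in_kernel_def by (intro iff_allI imp_cong refl)
qed

lemma in_kernel_contract:
  assumes "in_kernel U (add_mset x X) \<delta> f"
  shows "in_kernel (span (insert x U)) X \<delta> f"
  unfolding in_kernel_def
proof (intro allI impI)
  fix v assume "facet_normal (span (insert x U)) X v"
  from facet_normal_contract[OF this] have "deg_below (U\<^sup>\<bottom>) v (off_count X v - \<delta>) f"
    using assms unfolding in_kernel_def by auto
  then show "deg_below ((span (insert x U))\<^sup>\<bottom>) v (off_count X v - \<delta>) f"
    by (rule deg_below_mono) (auto simp: orthogonal_comp_insert_span)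
qed

lemma in_kernel_drop:
  assumes "in_kernel U (add_mset x X) \<delta> f" "x \<in> U"
  shows "in_kernel U X \<delta> f"
  unfolding in_kernel_def
proof (intro allI impI)
  fix v assume v: "facet_normal U X v"
  then have "v \<bullet> x = 0"
    using facet_normal_orthogonal[OF v] assms(2)
    by (auto simp: orthogonal_comp_def orthogonal_def inner_commute)
  then show "deg_below (U\<^sup>\<bottom>) v (off_count X v - \<delta>) f"
    using assms(1) facet_normal_add_mset[OF v, of x] unfolding in_kernel_def by auto
qed

text \<open>Each exponent drops by one exactly when v does not annihilate x, which matches the
  degree lost by cancelling x.t. The bound on \<delta> keeps the truncated difference honest: Suc m
  - \<delta> must equal Suc (m - \<delta>).\<close>

lemma in_kernel_cancel:
  assumes "subspace U" "x \<notin> U" "polyfun g"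
    and "\<And>v. facet_normal U X v \<Longrightarrow> \<delta> \<le> off_count X v"
    and "in_kernel U (add_mset x X) \<delta> (\<lambda>t. of_real (x \<bullet> t) * g t)"
  shows "in_kernel U X \<delta> g"
  unfolding in_kernel_def
proof (intro allI impI)
  fix v assume v: "facet_normal U X v"
  obtain w where w: "w \<in> U\<^sup>\<bottom>" "x \<bullet> w \<noteq> 0"
    using component_orthogonal[OF assms(1,2)] by blast
  have "deg_below (U\<^sup>\<bottom>) v (off_count (add_mset x X) v - \<delta>) (\<lambda>t. of_real (x \<bullet> t) * g t)"
    using assms(5) facet_normal_add_mset[OF v] unfolding in_kernel_def by blast
  moreover have "off_count (add_mset x X) v - \<delta> =
      (if x \<bullet> v = 0 then off_count X v - \<delta> else Suc (off_count X v - \<delta>))"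
    using assms(4)[OF v] by (simp add: inner_commute Suc_diff_le)
  ultimately have "deg_below (U\<^sup>\<bottom>) v
      (if x \<bullet> v = 0 then off_count X v - \<delta> else Suc (off_count X v - \<delta>))
      (\<lambda>t. of_real (x \<bullet> t) * g t)"
    by (simp only:)
  then show "deg_below (U\<^sup>\<bottom>) v (off_count X v - \<delta>) g"
    by (rule deg_below_cancel_linear[OF assms(3) subspace_orthogonal_comp w])
qed

text \<open>The second alternative of the last hypothesis admits deletions of coloops into the
  induction: there the kernel is zero on \<open>U\<^sup>\<bottom>\<close>, and 0 is always in
  \<open>P_rel\<close>.\<close>

theorem in_kernel_imp_P_rel:
  assumes "subspace U" "polyfun f" "in_kernel U X 0 f"
    and "span (U \<union> set_mset X) = UNIV \<or> (\<exists>v. facet_normal U X v \<and> off_count X v = 0)"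
  shows "\<exists>h\<in>P_rel U X. \<forall>t\<in>U\<^sup>\<bottom>. f t = h t"
  using assms
proof (induction X arbitrary: U f)
  case empty
  show ?case
  proof (cases "span (U \<union> set_mset {#}) = UNIV")
    case True
    moreover have "span U = U"
      using empty.prems(1) span_eq_iff by blast
    ultimately have U: "U = UNIV"
      by simp
    \<comment> \<open>The complement of U is just the origin, so the constant f 0 represents
      f.\<close>
    have "(\<lambda>t. f 0 * (\<Prod>y\<in>#{#}. complex_of_real (y \<bullet> t))) \<in> P_rel U {#}"
      unfolding P_rel_def
      by (intro cfun.span_scale cfun.span_base CollectI exI[of _ "{#}"]) (use True in simp)
    then show ?thesis
      by (rule bexI[rotated]) (simp add: U)
  next
    case False
    then obtain v where "facet_normal U {#} v"
      using empty.prems(4) by blast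
    then have "deg_below (U\<^sup>\<bottom>) v 0 f"
      using empty.prems(3) unfolding in_kernel_def by fastforce
    then show ?thesis
      by (intro bexI[OF _ P_rel_0]) (simp add: deg_below_0D)
  qed
next
  case (add x X)
  note IH = add.IH and U = \<open>subspace U\<close> and f = \<open>polyfun f\<close> and ker = \<open>in_kernel U _ 0 f\<close>
  show ?case
  proof (cases "span (U \<union> set_mset (add_mset x X)) = UNIV")
    case False
    then obtain v where "facet_normal U (add_mset x X) v" "off_count (add_mset x X) v = 0"
      using add.prems(4) by blast
    then have "deg_below (U\<^sup>\<bottom>) v 0 f"
      using ker unfolding in_kernel_def by (metis diff_0_eq_0)
    then show ?thesis
      by (intro bexI[OF _ P_rel_0]) (simp add: deg_below_0D)
  next
    case span: True
    show ?thesis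
    proof (cases "x \<in> U")
      case True
      \<comment> \<open>An element of U is a loop of the contraction: every facet normal annihilates
        it, so dropping it changes no exponent.\<close>
      then have "U \<union> set_mset (add_mset x X) = U \<union> set_mset X" by auto
      then show ?thesis
        using IH[OF U f in_kernel_drop[OF ker True]] span P_rel_add_mset[of U X x]
        by (metis subsetD)
    next
      case x: False
      let ?U = "span (insert x U)"
      have "span (?U \<union> set_mset X) = span (insert x U \<union> set_mset X)"
        by (rule span_Un_span)
      then have "span (?U \<union> set_mset X) = UNIV"
        using span by simp
      then obtain h where h: "h \<in> P_rel ?U X" "\<forall>t\<in>?U\<^sup>\<bottom>. f t = h t"
        using IH[OF subspace_span f in_kernel_contract[OF ker]] by blast
      then have h': "h \<in> P_rel U (add_mset x X)"
        using P_rel_contract by blast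
      \<comment> \<open>The lift h agrees with f where x.t = 0, so the error is divisible by x.t and
        its cofactor belongs to the deletion.\<close>
      obtain g where g: "polyfun g" "\<forall>t\<in>U\<^sup>\<bottom>. f t - h t = of_real (x \<bullet> t) * g t"
        using polyfun_divide[OF polyfun_diff[OF f P_rel_polyfun[OF h']] U x] h(2) by force
      have "in_kernel U (add_mset x X) 0 h"
        unfolding in_kernel_def
        using P_rel_deg_below[OF h'] facet_normal_orthogonal[of U "add_mset x X"]
        by (simp add: facet_normal_def)
      then have "in_kernel U (add_mset x X) 0 (\<lambda>t. of_real (x \<bullet> t) * g t)"
        using in_kernel_diff[OF ker] g(2)
        by (subst in_kernel_cong[of U _ "\<lambda>t. f t - h t"]) auto
      then have "in_kernel U X 0 g"
        by (rule in_kernel_cancel[OF U x g(1), rotated]) simp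
      moreover have "span (U \<union> set_mset X) = UNIV \<or> (\<exists>v. facet_normal U X v \<and> off_count X v = 0)"
        using facet_normal_coloop[OF span] by metis
      ultimately obtain k where k: "k \<in> P_rel U X" "\<forall>t\<in>U\<^sup>\<bottom>. g t = k t"
        using IH[OF U g(1)] by blast
      have "h + (\<lambda>t. of_real (x \<bullet> t) * k t) \<in> P_rel U (add_mset x X)"
        using h' P_rel_mult[OF k(1)] unfolding P_rel_def by (rule cfun.span_add)
      moreover have "\<forall>t\<in>U\<^sup>\<bottom>. f t = (h + (\<lambda>t. of_real (x \<bullet> t) * k t)) t"
        using g(2) k(2) by (auto simp: algebra_simps)
      ultimately show ?thesis by blast
    qed
  qed
qed

section \<open>Lattice points in the interior of a zonotope\<close>

lemma zonotope_empty [simp]: "zonotope {#} = {0}"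
proof -
  have "\<exists>t :: real ^ 'a \<Rightarrow> nat \<Rightarrow> real. \<forall>x k. t x k \<in> {0..1}"
    by (rule exI[of _ "\<lambda>_ _. 0"]) simp
  then show ?thesis by (simp add: zonotope_def)
qed

text \<open>The new copy of x carries the index \<open>count X x\<close>, so its term splits off as
  a segment. Minkowski sums then replace coefficient functions in all inductions over X.\<close>

lemma zonotope_add_mset:
  "zonotope (add_mset x X) = zonotope X + (\<lambda>s. s *\<^sub>R x) ` {0..1}" (is "?L = ?R")
proof -
  let ?A = "set_mset (add_mset x X)"
  let ?S = "\<lambda>X t. \<Sum>y\<in>?A. \<Sum>k<count X y. t y k *\<^sub>R y"
  have S: "(\<Sum>y\<in>set_mset X. \<Sum>k<count X y. t y k *\<^sub>R y) = ?S X t" for t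
    by (rule sum.mono_neutral_left) (auto simp: not_in_iff)
  have split: "?S (add_mset x X) t = ?S X t + t x (count X x) *\<^sub>R x" for t
  proof -
    have "?S (add_mset x X) t =
      (\<Sum>y\<in>?A. (\<Sum>k<count X y. t y k *\<^sub>R y) + (if y = x then t x (count X x) *\<^sub>R x else 0))"
      by (rule sum.cong) auto
    also have "\<dots> = ?S X t + t x (count X x) *\<^sub>R x"
      unfolding sum.distrib by (subst sum.delta) auto
    finally show ?thesis .
  qed
  show ?thesis
  proof
    show "?L \<subseteq> ?R"
    proof
      fix z assume "z \<in> ?L"
      then obtain t where t: "\<forall>x k. t x k \<in> {0..1::real}" "z = ?S (add_mset x X) t"
        unfolding zonotope_def by blast
      have "?S X t \<in> zonotope X"
        unfolding zonotope_def S using t(1) by blast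
      moreover have "t x (count X x) *\<^sub>R x \<in> (\<lambda>s. s *\<^sub>R x) ` {0..1}"
        using t(1) by blast
      ultimately show "z \<in> ?R"
        unfolding t(2) split by (rule set_plus_intro)
    qed
    show "?R \<subseteq> ?L"
    proof
      fix z assume "z \<in> ?R"
      then obtain t s where t: "\<forall>x k. t x k \<in> {0..1::real}" "s \<in> {0..1}" "z = ?S X t + s *\<^sub>R x"
        unfolding zonotope_def S by (elim set_plus_elim) blast
      define t' where "t' = t(x := (t x)(count X x := s))"
      have "?S X t' = ?S X t"
        by (intro sum.cong) (auto simp: t'_def)
      then have "z = ?S (add_mset x X) t'"
        unfolding split t(3) by (simp add: t'_def)
      moreover have "\<forall>x k. t' x k \<in> {0..1}"
        using t(1,2) by (simp add: t'_def)
      ultimately show "z \<in> ?L"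
        unfolding zonotope_def by blast
    qed
  qed
qed

lemma convex_zonotope: "convex (zonotope X)"
proof (induction X)
  case (add x X)
  have "convex ((\<lambda>s::real. s *\<^sub>R x) ` {0..1})"
    by (rule convex_linear_image) (auto intro: linearI simp: scaleR_add_left)
  then show ?case
    using add by (simp add: zonotope_add_mset convex_set_plus)
qed simp

lemma zero_in_zonotope: "0 \<in> zonotope X"
proof (induction X)
  case (add x X)
  have "0 \<in> (\<lambda>s::real. s *\<^sub>R x) ` {0..1}"
    by force
  then show ?case
    using set_plus_intro[OF add] by (force simp: zonotope_add_mset)
qed simp

lemma zonotope_subset_add_mset: "zonotope X \<subseteq> zonotope (add_mset x X)"
proof
  fix z assume "z \<in> zonotope X"
  moreover have "0 \<in> (\<lambda>s::real. s *\<^sub>R x) ` {0..1}"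
    by force
  ultimately show "z \<in> zonotope (add_mset x X)"
    unfolding zonotope_add_mset by (metis add.right_neutral set_plus_intro)
qed

lemma set_mset_subset_zonotope: "set_mset X \<subseteq> zonotope X"
proof (induction X)
  case (add x X)
  have "x \<in> (\<lambda>s::real. s *\<^sub>R x) ` {0..1}"
    by (rule image_eqI[of _ _ 1]) auto
  then have "x \<in> zonotope (add_mset x X)"
    unfolding zonotope_add_mset by (metis add.left_neutral set_plus_intro zero_in_zonotope)
  then show ?case
    using add zonotope_subset_add_mset by fastforce
qed simp

text \<open>Thickening by U gives the preimage of the zonotope of the contraction, so its interior
  lattice points are represented by points of Z^n. For U = {0} this is
  \<open>Z_minus X\<close>.\<close>

definition lattice_int :: "(real ^ 'n) set \<Rightarrow> (real ^ 'n) multiset \<Rightarrow> (real ^ 'n) set" where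
  "lattice_int U X = interior (zonotope X + U) \<inter> integer_points"

lemma integer_points_add: "a \<in> integer_points \<Longrightarrow> b \<in> integer_points \<Longrightarrow> a + b \<in> integer_points"
  by (simp add: integer_points_def)

lemma integer_points_scale: "a \<in> integer_points \<Longrightarrow> of_int k *\<^sub>R a \<in> integer_points"
  by (simp add: integer_points_def)

lemma interior_zonotope_shift:
  assumes "z \<in> interior (zonotope X + U)" "s \<in> {0..1}"
  shows "z + s *\<^sub>R x \<in> interior (zonotope (add_mset x X) + U)"
proof -
  let ?T = "(+) (s *\<^sub>R x) ` interior (zonotope X + U)"
  have "?T \<subseteq> zonotope (add_mset x X) + U"
  proof
    fix y assume "y \<in> ?T"
    then obtain w where w: "w \<in> zonotope X + U" "y = s *\<^sub>R x + w"
      using interior_subset by blast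
    then obtain a u where "a \<in> zonotope X" "u \<in> U" "w = a + u"
      by (elim set_plus_elim)
    moreover from this have "a + s *\<^sub>R x \<in> zonotope (add_mset x X)"
      unfolding zonotope_add_mset using assms(2) by (intro set_plus_intro imageI)
    moreover have "y = (a + s *\<^sub>R x) + u"
      using calculation w(2) by simp
    ultimately show "y \<in> zonotope (add_mset x X) + U"
      using set_plus_intro by blast
  qed
  moreover have "open ?T"
    by (rule open_translation) simp
  ultimately have "?T \<subseteq> interior (zonotope (add_mset x X) + U)"
    by (rule interior_maximal)
  then show ?thesis
    using assms(1) by (auto simp: add.commute)
qed

text \<open>The two ends of the segment from 0 to x. Together they keep the frequencies of (e^x - 1)
  F interior when those of F are interior for the deletion.\<close>

lemma lattice_int_shift:
  assumes "\<alpha> \<in> lattice_int U X" "x \<in> integer_points"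
  shows "\<alpha> \<in> lattice_int U (add_mset x X)" "\<alpha> + x \<in> lattice_int U (add_mset x X)"
  using assms interior_zonotope_shift[of \<alpha> X U 0 x] interior_zonotope_shift[of \<alpha> X U 1 x]
  by (auto simp: lattice_int_def integer_points_add)

text \<open>A convex set with empty interior lies in a hyperplane. This one contains 0, U and X, so
  the normal would annihilate a spanning set.\<close>

lemma interior_zonotope_nonempty:
  assumes "subspace U" "span (U \<union> set_mset X) = UNIV"
  shows "interior (zonotope X + U) \<noteq> {}"
proof
  let ?C = "zonotope X + U"
  assume int: "interior ?C = {}"
  have "convex ?C"
    using assms(1) by (simp add: convex_set_plus convex_zonotope subspace_imp_convex)
  then obtain a b where ab: "a \<noteq> 0" "?C \<subseteq> {x. a \<bullet> x = b}"
    using int by (rule empty_interior_subset_hyperplane)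
  have 0: "0 \<in> U" using assms(1) by (rule subspace_0)
  have "0 + 0 \<in> ?C"
    using zero_in_zonotope 0 by (rule set_plus_intro)
  then have b: "b = 0" using ab(2) by auto
  have "a = 0"
  proof (rule orthogonal_span_UNIV[OF assms(2)])
    fix x assume "x \<in> U \<union> set_mset X"
    then have "x \<in> ?C"
    proof
      assume "x \<in> U"
      then have "0 + x \<in> ?C" by (intro set_plus_intro zero_in_zonotope)
      then show ?thesis by simp
    next
      assume "x \<in># X"
      then have "x + 0 \<in> ?C" using set_mset_subset_zonotope 0 by (intro set_plus_intro) auto
      then show ?thesis by simp
    qed
    then show "a \<bullet> x = 0" using ab(2) b by blast
  qed
  then show False using ab(1) by simp
qed

text \<open>The zonotope thickened by the larger subspace is contained in the sum of C (the zonotope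
  plus U) and the line through x. Relative interiors add, so \<alpha> = z + s x with z interior to
  C, and it remains to round s.\<close>

lemma lattice_int_lift:
  assumes U: "subspace U" and span: "span (U \<union> set_mset X) = UNIV"
    and x: "x \<in> integer_points" and \<alpha>: "\<alpha> \<in> lattice_int (span (insert x U)) X"
  shows "\<exists>k::int. \<alpha> - of_int k *\<^sub>R x \<in> lattice_int U (add_mset x X)"
proof -
  let ?C = "zonotope X + U"
  let ?L = "range (\<lambda>k::real. k *\<^sub>R x)"
  have "zonotope X + span (insert x U) \<subseteq> ?C + ?L"
  proof
    fix z assume "z \<in> zonotope X + span (insert x U)"
    then obtain a w where w: "a \<in> zonotope X" "w \<in> span (insert x U)" "z = a + w"
      by (elim set_plus_elim)
    obtain k where "w - k *\<^sub>R x \<in> span U"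
      using w(2) unfolding span_insert by blast
    moreover have "span U = U" using U span_eq_iff by blast
    ultimately have "(a + (w - k *\<^sub>R x)) + k *\<^sub>R x \<in> ?C + ?L"
      using w(1) by (intro set_plus_intro rangeI) auto
    then show "z \<in> ?C + ?L" using w(3) by simp
  qed
  then have "\<alpha> \<in> interior (?C + ?L)"
    using \<alpha> interior_mono unfolding lattice_int_def by blast
  then have "\<alpha> \<in> rel_interior (?C + ?L)"
    using interior_subset_rel_interior by blast
  moreover have "convex ?C"
    using U by (simp add: convex_set_plus convex_zonotope subspace_imp_convex)
  moreover have "convex ?L"
    by (rule convex_linear_image) (auto intro: linearI simp: scaleR_add_left)
  ultimately have "\<alpha> \<in> rel_interior ?C + rel_interior ?L"
    by (simp add: rel_interior_sum)
  then obtain z l where z: "z \<in> rel_interior ?C" "l \<in> rel_interior ?L" "\<alpha> = z + l"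
    by (elim set_plus_elim)
  have "z \<in> interior ?C"
    using z(1) rel_interior_nonempty_interior[OF interior_zonotope_nonempty[OF U span]] by simp
  moreover obtain s where s: "l = s *\<^sub>R x"
    using z(2) rel_interior_subset by blast
  \<comment> \<open>The fractional part of s is absorbed by the segment that x adds to the zonotope;
    the floor of s becomes the integer multiple to subtract.\<close>
  ultimately have "z + frac s *\<^sub>R x \<in> interior (zonotope (add_mset x X) + U)"
    by (intro interior_zonotope_shift) (auto simp: frac_ge_0 frac_lt_1 less_imp_le)
  moreover have "z + frac s *\<^sub>R x = \<alpha> - of_int \<lfloor>s\<rfloor> *\<^sub>R x"
    unfolding z(3) s frac_def by (simp add: algebra_simps)
  moreover have "\<alpha> + of_int (- \<lfloor>s\<rfloor>) *\<^sub>R x \<in> integer_points"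
    using \<alpha> x by (intro integer_points_add integer_points_scale) (auto simp: lattice_int_def)
  ultimately show ?thesis
    unfolding lattice_int_def by (intro exI[of _ "\<lfloor>s\<rfloor>"]) simp
qed

text \<open>M and N count the elements of X on which v takes the values -1 and 1; each lengthens the
  range of v on the zonotope by one at one end.\<close>

lemma inner_zonotope_bounds:
  assumes "v \<in> U\<^sup>\<bottom>" "\<And>x. x \<in># X \<Longrightarrow> v \<bullet> x \<in> {-1, 0, 1}"
  shows "\<exists>M N. off_count X v = M + N \<and>
    (\<forall>z\<in>zonotope X + U. - real M \<le> v \<bullet> z \<and> v \<bullet> z \<le> real N)"
  using assms(2)
proof (induction X)
  case empty
  have "v \<bullet> z = 0" if "z \<in> zonotope {#} + U" for z
    using that assms(1) unfolding orthogonal_comp_def orthogonal_def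
    by (auto simp: inner_commute elim!: set_plus_elim)
  then show ?case by (intro exI[of _ 0]) auto
next
  case (add x X)
  then obtain M N where MN: "off_count X v = M + N"
    "\<And>z. z \<in> zonotope X + U \<Longrightarrow> - real M \<le> v \<bullet> z \<and> v \<bullet> z \<le> real N"
    by auto
  have ex: "\<exists>w\<in>zonotope X + U. \<exists>s\<in>{0..1}. z = w + s *\<^sub>R x"
    if z: "z \<in> zonotope (add_mset x X) + U" for z
  proof -
    obtain a s u where "a \<in> zonotope X" "s \<in> {0..1}" "u \<in> U" "z = (a + s *\<^sub>R x) + u"
      using z unfolding zonotope_add_mset by (auto elim!: set_plus_elim)
    then show ?thesis
      by (intro bexI[of _ "a + u"] bexI[of _ s]) (auto intro: set_plus_intro)
  qed
  consider "v \<bullet> x = 0" | "v \<bullet> x = 1" | "v \<bullet> x = -1"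
    using add.prems[of x] by auto
  then show ?case
  proof cases
    case 1
    have "- real M \<le> v \<bullet> z \<and> v \<bullet> z \<le> real N" if "z \<in> zonotope (add_mset x X) + U" for z
      using ex[OF that] MN(2) 1 by (auto simp: inner_add_right)
    then show ?thesis using 1 MN(1) by auto
  next
    case 2
    have "- real M \<le> v \<bullet> z \<and> v \<bullet> z \<le> real (Suc N)" if "z \<in> zonotope (add_mset x X) + U" for z
      using ex[OF that] MN(2) 2 by (force simp: inner_add_right)
    then show ?thesis using 2 MN(1) by (intro exI[of _ M] exI[of _ "Suc N"]) auto
  next
    case 3
    have "- real (Suc M) \<le> v \<bullet> z \<and> v \<bullet> z \<le> real N" if "z \<in> zonotope (add_mset x X) + U" for z
      using ex[OF that] MN(2) 3 by (force simp: inner_add_right)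
    then show ?thesis using 3 MN(1) by (intro exI[of _ "Suc M"] exI[of _ N]) auto
  qed
qed

text \<open>An interior point can be moved a little both along v and against it, so both bounds
  become strict. This strictness is the source of the 1 subtracted from m(H).\<close>

lemma inner_interior_zonotope_bounds:
  assumes "v \<in> U\<^sup>\<bottom>" "v \<noteq> 0" "\<And>x. x \<in># X \<Longrightarrow> v \<bullet> x \<in> {-1, 0, 1}"
  obtains M N where "off_count X v = M + N"
    "\<And>z. z \<in> interior (zonotope X + U) \<Longrightarrow> - real M < v \<bullet> z \<and> v \<bullet> z < real N"
proof -
  obtain M N where MN: "off_count X v = M + N"
    "\<And>z. z \<in> zonotope X + U \<Longrightarrow> - real M \<le> v \<bullet> z \<and> v \<bullet> z \<le> real N"
    using inner_zonotope_bounds[OF assms(1,3)] by blast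
  have "- real M < v \<bullet> z \<and> v \<bullet> z < real N" if z: "z \<in> interior (zonotope X + U)" for z
  proof -
    obtain e where e: "e > 0" "cball z e \<subseteq> zonotope X + U"
      using z mem_interior_cball by blast
    define w where "w = (e / norm v) *\<^sub>R v"
    have w: "norm w = e" "v \<bullet> w > 0"
      using assms(2) e(1) by (simp_all add: w_def)
    have "z + w \<in> cball z e" "z - w \<in> cball z e"
      using w(1) by (simp_all add: dist_norm)
    then have "v \<bullet> (z + w) \<le> real N" "- real M \<le> v \<bullet> (z - w)"
      using e(2) MN(2) by blast+
    then show ?thesis using w(2) by (simp add: inner_add_right inner_diff_right)
  qed
  then show ?thesis using that MN(1) by blast
qed

section \<open>Power series of exponential sums\<close>

text \<open>An exponential sum is represented by the family of its homogeneous components, as a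
  function of the degree and the argument.\<close>

definition jet :: "real ^ 'n \<Rightarrow> nat \<times> (real ^ 'n) \<Rightarrow> complex" where
  "jet \<alpha> = (\<lambda>(j, t). of_real ((\<alpha> \<bullet> t) ^ j / fact j))"

definition jets :: "(real ^ 'n::finite) set \<Rightarrow> (nat \<times> (real ^ 'n) \<Rightarrow> complex) set" where
  "jets \<sigma> = cfun.span (jet ` \<sigma>)"

lemma jets_induct [consumes 1, case_names zero step]:
  assumes "G \<in> jets \<sigma>" "P (\<lambda>_. 0)"
    and "\<And>c \<alpha> G. \<alpha> \<in> \<sigma> \<Longrightarrow> G \<in> jets \<sigma> \<Longrightarrow> P G \<Longrightarrow> P (\<lambda>jt. c * jet \<alpha> jt + G jt)"
  shows "P G"
proof -
  have "G \<in> jets \<sigma> \<and> P G"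
    using assms(1) unfolding jets_def
  proof (induction rule: cfun.span_induct_alt)
    case base
    then show ?case using assms(2) cfun.span_zero by (simp add: zero_fun_def)
  next
    case (step c x y)
    then obtain \<alpha> where "\<alpha> \<in> \<sigma>" "x = jet \<alpha>" by blast
    with step assms(3)[of \<alpha> y c] show ?case
      unfolding jets_def plus_fun_def
      using cfun.span_add[OF cfun.span_scale[OF cfun.span_base[of x "jet ` \<sigma>"], of c], of y]
      by (simp add: plus_fun_def)
  qed
  then show ?thesis ..
qed

lemma jets_add: "F \<in> jets \<sigma> \<Longrightarrow> G \<in> jets \<sigma> \<Longrightarrow> (\<lambda>jt. F jt + G jt) \<in> jets \<sigma>"
  using cfun.span_add unfolding jets_def plus_fun_def by blast

lemma jets_scale: "G \<in> jets \<sigma> \<Longrightarrow> (\<lambda>jt. c * G jt) \<in> jets \<sigma>"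
  using cfun.span_scale unfolding jets_def by blast

lemma jets_diff: "F \<in> jets \<sigma> \<Longrightarrow> G \<in> jets \<sigma> \<Longrightarrow> (\<lambda>jt. F jt - G jt) \<in> jets \<sigma>"
  using jets_add[OF _ jets_scale[of G \<sigma> "-1"]] by simp

lemma jets_zero: "(\<lambda>_. 0) \<in> jets \<sigma>"
  using cfun.span_zero unfolding jets_def zero_fun_def by blast

lemma jet_in_jets: "\<alpha> \<in> \<sigma> \<Longrightarrow> jet \<alpha> \<in> jets \<sigma>"
  unfolding jets_def by (intro cfun.span_base imageI)

lemma jets_mono: "\<sigma> \<subseteq> \<tau> \<Longrightarrow> jets \<sigma> \<subseteq> jets \<tau>"
  unfolding jets_def by (intro cfun.span_mono image_mono)

lemma jets_polyfun: "G \<in> jets \<sigma> \<Longrightarrow> polyfun (\<lambda>t. G (j, t))"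
proof (induction rule: jets_induct)
  case zero
  show ?case by (rule polyfun_const)
next
  case (step c \<alpha> G)
  have "polyfun (\<lambda>t. of_real (\<alpha> \<bullet> t) ^ j * (1 / fact j))"
    by (intro polyfun_mult polyfun_power polyfun_inner polyfun_const)
  then have "polyfun (\<lambda>t. jet \<alpha> (j, t))"
    by (simp add: jet_def)
  then show ?case
    using step by (intro polyfun_add polyfun_scale)
qed

lemma jets_homogeneous: "G \<in> jets \<sigma> \<Longrightarrow> G (j, s *\<^sub>R t) = of_real s ^ j * G (j, t)"
  by (induction rule: jets_induct) (simp_all add: jet_def power_mult_distrib algebra_simps)

lemma power_add_divide_fact:
  "((a::real) + b) ^ j / fact j = (\<Sum>i\<le>j. (a ^ i / fact i) * (b ^ (j - i) / fact (j - i)))"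
  using exp_series_add_commuting[of a b j] by (simp add: divide_inverse mult.commute)

text \<open>Multiplication by e^x on homogeneous components: the Cauchy product with the exponential
  series of x.t.\<close>

definition jet_shift :: "real ^ 'n \<Rightarrow> (nat \<times> (real ^ 'n) \<Rightarrow> complex) \<Rightarrow> nat \<times> (real ^ 'n) \<Rightarrow> complex" where
  "jet_shift x G = (\<lambda>(j, t). \<Sum>i\<le>j. of_real ((x \<bullet> t) ^ i / fact i) * G (j - i, t))"

lemma jet_shift_jet: "jet_shift x (jet \<alpha>) = jet (\<alpha> + x)"
proof -
  have "((\<alpha> + x) \<bullet> t) ^ j / fact j =
      (\<Sum>i\<le>j. ((x \<bullet> t) ^ i / fact i) * ((\<alpha> \<bullet> t) ^ (j - i) / fact (j - i)))" for j t
    using power_add_divide_fact[of "x \<bullet> t" "\<alpha> \<bullet> t" j] by (simp add: inner_add_left add.commute)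
  then show ?thesis
    unfolding jet_shift_def jet_def by (simp add: fun_eq_iff del: of_real_divide flip: of_real_mult of_real_sum)
qed

lemma jet_shift_jets:
  assumes "G \<in> jets \<sigma>" "\<And>\<alpha>. \<alpha> \<in> \<sigma> \<Longrightarrow> \<alpha> + x \<in> \<tau>"
  shows "jet_shift x G \<in> jets \<tau>"
  using assms(1)
proof (induction rule: jets_induct)
  case zero
  show ?case using jets_zero by (simp add: jet_shift_def case_prod_beta)
next
  case (step c \<alpha> G)
  have "jet_shift x (\<lambda>jt. c * jet \<alpha> jt + G jt) =
      (\<lambda>jt. c * jet_shift x (jet \<alpha>) jt + jet_shift x G jt)"
    by (simp add: jet_shift_def fun_eq_iff sum_distrib_left sum.distrib algebra_simps)
  then show ?case
    using step assms(2) by (simp add: jet_shift_jet jets_add jets_scale jet_in_jets)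
qed

text \<open>On V a frequency matters only through its inner products with V, so each one may be
  replaced by a representative with the same products.\<close>

lemma jets_lift:
  assumes "G \<in> jets \<sigma>" "\<And>\<alpha>. \<alpha> \<in> \<sigma> \<Longrightarrow> \<exists>\<beta>\<in>\<tau>. \<forall>t\<in>V. \<beta> \<bullet> t = \<alpha> \<bullet> t"
  shows "\<exists>F\<in>jets \<tau>. \<forall>j. \<forall>t\<in>V. F (j, t) = G (j, t)"
  using assms(1)
proof (induction rule: jets_induct)
  case zero
  show ?case using jets_zero by (intro bexI) auto
next
  case (step c \<alpha> G)
  then obtain F where F: "F \<in> jets \<tau>" "\<forall>j. \<forall>t\<in>V. F (j, t) = G (j, t)" by blast
  obtain \<beta> where \<beta>: "\<beta> \<in> \<tau>" "\<forall>t\<in>V. \<beta> \<bullet> t = \<alpha> \<bullet> t"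
    using assms(2) step by blast
  show ?case
  proof (rule bexI)
    show "(\<lambda>jt. c * jet \<beta> jt + F jt) \<in> jets \<tau>"
      using F \<beta> by (simp add: jets_add jets_scale jet_in_jets)
  qed (use F \<beta> in \<open>auto simp: jet_def\<close>)
qed

section \<open>Least parts of exponential sums lie in the kernel\<close>

text \<open>The coefficients \<open>R i l\<close> are, up to factorials, the directional derivatives of order \<open>i\<close>
  of the homogeneous components; a polynomial vanishing at the frequencies in direction \<open>v\<close>
  gives a linear recurrence for them.\<close>

lemma jets_directional:
  fixes q :: "complex poly"
  assumes "G \<in> jets \<sigma>" "\<And>\<alpha>. \<alpha> \<in> \<sigma> \<Longrightarrow> poly q (of_real (v \<bullet> \<alpha>)) = 0"
  shows "\<exists>R. (\<forall>j t s. G (j, t + s *\<^sub>R v) =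
        (\<Sum>i\<le>j. of_real s ^ i / fact i * R i (j - i) t)) \<and>
      (\<forall>r l t. (\<Sum>k\<le>degree q. coeff q k * R (k + r) l t) = 0)"
  using assms(1)
proof (induction rule: jets_induct)
  case zero
  show ?case by (rule exI[of _ "\<lambda>_ _ _. 0"]) simp
next
  case (step c \<alpha> G)
  then obtain R where R: "\<And>j t s. G (j, t + s *\<^sub>R v) =
        (\<Sum>i\<le>j. of_real s ^ i / fact i * R i (j - i) t)"
      "\<And>r l t. (\<Sum>k\<le>degree q. coeff q k * R (k + r) l t) = 0"
    by blast
  \<comment> \<open>From the binomial expansion of (\<alpha>.t + s v.\<alpha>)^j. The factor
    (v.\<alpha>)^i makes the recurrence sum a multiple of the value of q at v.\<alpha>, which is
    0.\<close>
  define Q where "Q = (\<lambda>i l t. complex_of_real ((v \<bullet> \<alpha>) ^ i) * of_real ((\<alpha> \<bullet> t) ^ l / fact l))"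
  have Q1: "jet \<alpha> (j, t + s *\<^sub>R v) = (\<Sum>i\<le>j. of_real s ^ i / fact i * Q i (j - i) t)" for j t s
  proof -
    have "(\<alpha> \<bullet> (t + s *\<^sub>R v)) ^ j / fact j =
        (\<Sum>i\<le>j. (s * (v \<bullet> \<alpha>)) ^ i / fact i * ((\<alpha> \<bullet> t) ^ (j - i) / fact (j - i)))"
      using power_add_divide_fact[of "s * (v \<bullet> \<alpha>)" "\<alpha> \<bullet> t" j]
      by (simp add: inner_add_right inner_commute add.commute)
    then have "jet \<alpha> (j, t + s *\<^sub>R v) =
        of_real (\<Sum>i\<le>j. (s * (v \<bullet> \<alpha>)) ^ i / fact i * ((\<alpha> \<bullet> t) ^ (j - i) / fact (j - i)))"
      by (simp only: jet_def prod.case)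
    then show ?thesis
      by (simp add: Q_def power_mult_distrib mult_ac)
  qed
  have Q2: "(\<Sum>k\<le>degree q. coeff q k * Q (k + r) l t) = 0" for r l t
  proof -
    have "(\<Sum>k\<le>degree q. coeff q k * Q (k + r) l t) =
        poly q (of_real (v \<bullet> \<alpha>)) * Q r l t"
      by (simp add: poly_altdef Q_def power_add sum_distrib_left sum_distrib_right sum_divide_distrib
        mult_ac)
    then show ?thesis using assms(2) step by simp
  qed
  show ?case
  proof (intro exI[of _ "\<lambda>i l t. c * Q i l t + R i l t"] conjI allI)
    show "c * jet \<alpha> (j, t + s *\<^sub>R v) + G (j, t + s *\<^sub>R v) =
        (\<Sum>i\<le>j. of_real s ^ i / fact i * (c * Q i (j - i) t + R i (j - i) t))" for j t s
      by (simp add: Q1 R(1) sum_distrib_left sum.distrib algebra_simps)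
    show "(\<Sum>k\<le>degree q. coeff q k * (c * Q (k + r) l t + R (k + r) l t)) = 0" for r l t
    proof -
      have "(\<Sum>k\<le>degree q. coeff q k * (c * Q (k + r) l t + R (k + r) l t)) =
          c * (\<Sum>k\<le>degree q. coeff q k * Q (k + r) l t) +
          (\<Sum>k\<le>degree q. coeff q k * R (k + r) l t)"
        by (simp add: sum_distrib_left sum.distrib algebra_simps)
      then show ?thesis by (simp add: Q2 R(2))
    qed
  qed
qed

text \<open>When all components below d vanish on V, the recurrence for the component of degree d is
  left with its leading term alone, so derivatives of order at least \<open>degree q\<close> along v
  are zero.\<close>

lemma jets_deg_below:
  fixes q :: "complex poly"
  assumes G: "G \<in> jets \<sigma>" and q: "\<And>\<alpha>. \<alpha> \<in> \<sigma> \<Longrightarrow> poly q (of_real (v \<bullet> \<alpha>)) = 0" "q \<noteq> 0"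
    and V: "subspace V" "v \<in> V" and low: "\<And>j t. j < d \<Longrightarrow> t \<in> V \<Longrightarrow> G (j, t) = 0"
  shows "deg_below V v (degree q) (\<lambda>t. G (d, t))"
  unfolding deg_below_def
proof
  fix t assume t: "t \<in> V"
  obtain R where R: "\<And>j t s. G (j, t + s *\<^sub>R v) =
        (\<Sum>i\<le>j. of_real s ^ i / fact i * R i (j - i) t)"
      "\<And>r l t. (\<Sum>k\<le>degree q. coeff q k * R (k + r) l t) = 0"
    using jets_directional[OF G q(1)] by blast
  define P where "P = (\<lambda>j. \<Sum>i\<le>j. monom (R i (j - i) t / fact i) i)"
  have P: "G (j, t + s *\<^sub>R v) = poly (P j) (of_real s)" for j s
    by (simp add: R(1) P_def poly_sum poly_monom mult.commute)
  have coeff_P: "coeff (P j) i = (if i \<le> j then R i (j - i) t / fact i else 0)" for i j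
    by (simp add: P_def coeff_sum sum.delta)
  have R0: "R i l t = 0" if "i + l < d" for i l
  proof -
    have "P (i + l) = 0"
    proof (rule poly_eqI_of_real[of UNIV])
      fix s :: real
      have "t + s *\<^sub>R v \<in> V" using t V by (simp add: subspace_add subspace_scale)
      then show "poly (P (i + l)) (of_real s) = poly 0 (of_real s)"
        using low[OF that] P[of "i + l" s] by simp
    qed (simp add: infinite_UNIV_char_0)
    then show ?thesis using coeff_P[of "i + l" i] by simp
  qed
  have "coeff (P d) i = 0" if i: "i \<ge> degree q" for i
  proof (cases "i \<le> d")
    case True
    let ?n = "degree q"
    have "0 = (\<Sum>k\<le>?n. coeff q k * R (k + (i - ?n)) (d - i) t)"
      using R(2) by simp
    \<comment> \<open>For k below the degree of q the two indices of R add up to less than d, where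
      \<open>R0\<close> applies.\<close>
    also have "\<dots> = (\<Sum>k\<in>{?n}. coeff q k * R (k + (i - ?n)) (d - i) t)"
    proof (rule sum.mono_neutral_right)
      show "\<forall>k\<in>{..?n} - {?n}. coeff q k * R (k + (i - ?n)) (d - i) t = 0"
        using i True by (auto intro!: R0)
    qed auto
    also have "\<dots> = lead_coeff q * R i (d - i) t"
      using i by simp
    finally show ?thesis using q(2) by (simp add: coeff_P)
  qed (simp add: coeff_P)
  then show "\<exists>P. (\<forall>i\<ge>degree q. coeff P i = 0) \<and>
      (\<forall>s::real. G (d, t + s *\<^sub>R v) = poly P (of_real s))"
    using P by blast
qed

text \<open>Unlike determinants of bases, this consequence of unimodularity makes sense relative to
  U and passes to deletions and contractions.\<close>

definition unimodular_normals :: "(real ^ 'n) set \<Rightarrow> (real ^ 'n) multiset \<Rightarrow> bool" where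
  "unimodular_normals U X \<longleftrightarrow> (\<forall>v. facet_normal U X v \<longrightarrow> (\<exists>c. c \<noteq> 0 \<and>
     (\<forall>z\<in>integer_points. (c *\<^sub>R v) \<bullet> z \<in> \<int>) \<and> (\<forall>x\<in>#X. (c *\<^sub>R v) \<bullet> x \<in> {-1, 0, 1})))"

lemma unimodular_normals_delete:
  "unimodular_normals U (add_mset x X) \<Longrightarrow> unimodular_normals U X"
  unfolding unimodular_normals_def using facet_normal_add_mset[of U X _ x] by fastforce

lemma unimodular_normals_contract:
  "unimodular_normals U (add_mset x X) \<Longrightarrow> unimodular_normals (span (insert x U)) X"
  unfolding unimodular_normals_def using facet_normal_contract(1)[of x U X] by fastforce

lemma jets_in_kernel:
  assumes G: "G \<in> jets (lattice_int U X)" and uni: "unimodular_normals U X"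
    and low: "\<And>j t. j < d \<Longrightarrow> t \<in> U\<^sup>\<bottom> \<Longrightarrow> G (j, t) = 0"
  shows "in_kernel U X 1 (\<lambda>t. G (d, t))"
  unfolding in_kernel_def
proof (intro allI impI)
  fix v assume v: "facet_normal U X v"
  then obtain c where c: "c \<noteq> 0" "\<And>z. z \<in> integer_points \<Longrightarrow> (c *\<^sub>R v) \<bullet> z \<in> \<int>"
    "\<And>x. x \<in># X \<Longrightarrow> (c *\<^sub>R v) \<bullet> x \<in> {-1, 0, 1}"
    using uni unfolding unimodular_normals_def by blast
  let ?w = "c *\<^sub>R v"
  have w: "?w \<in> U\<^sup>\<bottom>" "?w \<noteq> 0"
    using c(1) v facet_normal_orthogonal[OF v]
    by (auto simp: facet_normal_def subspace_scale subspace_orthogonal_comp)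
  obtain M N where MN: "off_count X ?w = M + N"
    "\<And>z. z \<in> interior (zonotope X + U) \<Longrightarrow> - real M < ?w \<bullet> z \<and> ?w \<bullet> z < real N"
    using inner_interior_zonotope_bounds[OF w c(3)] by blast
  let ?A = "{- int M <..< int N}"
  \<comment> \<open>The roots are the integers strictly between -M and N, the only values a scaled
    normal can take at an interior lattice point. There are M + N - 1 of them; for M = N = 0 the
    empty product agrees with the truncated exponent.\<close>
  define q where "q = (\<Prod>k\<in>?A. [:- complex_of_int k, 1:])"
  have "degree q = card ?A"
    by (simp add: q_def degree_prod_sum_eq)
  moreover have "card ?A = off_count X v - 1"
    using MN(1) c(1) by (simp add: off_count_def)
  ultimately have deg: "degree q = off_count X v - 1" by simp
  have "poly q (of_real (?w \<bullet> \<alpha>)) = 0" if \<alpha>: "\<alpha> \<in> lattice_int U X" for \<alpha>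
  proof -
    obtain k where k: "?w \<bullet> \<alpha> = of_int k"
      using c(2)[of \<alpha>] \<alpha> by (auto simp: lattice_int_def elim: Ints_cases)
    have "- real M < ?w \<bullet> \<alpha>" "?w \<bullet> \<alpha> < real N"
      using MN(2)[of \<alpha>] \<alpha> by (auto simp: lattice_int_def)
    then have "k \<in> ?A" unfolding k by auto
    then show ?thesis
      unfolding k q_def by (auto simp: poly_prod)
  qed
  moreover have "q \<noteq> 0" by (simp add: q_def)
  ultimately have "deg_below (U\<^sup>\<bottom>) ?w (degree q) (\<lambda>t. G (d, t))"
    using G low w(1) by (intro jets_deg_below) (auto simp: subspace_orthogonal_comp)
  from deg_below_scaleR[OF this, of "inverse c"]
  show "deg_below (U\<^sup>\<bottom>) v (off_count X v - 1) (\<lambda>t. G (d, t))"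
    using c(1) by (simp add: deg)
qed

section \<open>Every homogeneous kernel element is a least part\<close>

lemma polyfun_invariant_dilation:
  assumes "polyfun q" "\<And>s::real. s \<noteq> 0 \<Longrightarrow> q (s *\<^sub>R t) = q t"
  shows "q 0 = q t"
proof -
  obtain p where p: "q = peval p"
    using assms(1) polyfun_iff_peval by blast
  have "line_poly 0 t p = [:q t:]"
  proof (rule poly_eqI_of_real[of "UNIV - {0}"])
    show "infinite (UNIV - {0::real})" by (simp add: infinite_UNIV_char_0)
  qed (use assms(2) in \<open>simp add: poly_line_poly p\<close>)
  then show ?thesis
    using poly_line_poly[of 0 t p 0] by (simp add: p)
qed

text \<open>Excluding s = 0 permits division by s when a linear factor is cancelled. The value at
  the origin is recovered by \<open>polyfun_invariant_dilation\<close> where it is needed.\<close>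

definition homogeneous_on :: "(real ^ 'n) set \<Rightarrow> nat \<Rightarrow> (real ^ 'n \<Rightarrow> complex) \<Rightarrow> bool" where
  "homogeneous_on V d f \<longleftrightarrow> (\<forall>t\<in>V. \<forall>s::real. s \<noteq> 0 \<longrightarrow> f (s *\<^sub>R t) = of_real s ^ d * f t)"

lemma homogeneous_on_cancel:
  assumes "polyfun g" "subspace V" "w \<in> V" "x \<bullet> w \<noteq> 0"
    and hom: "homogeneous_on V (Suc e) q" and q: "\<And>t. t \<in> V \<Longrightarrow> q t = of_real (x \<bullet> t) * g t"
  shows "homogeneous_on V e g"
  unfolding homogeneous_on_def
proof (intro ballI allI impI)
  fix t :: "real ^ 'a" and s :: real
  assume t: "t \<in> V" and s: "s \<noteq> 0"
  have "g (s *\<^sub>R t) - of_real s ^ e * g t = 0"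
  proof (rule polyfun_cancel_linear[OF _ assms(2-4) _ t])
    have "linear (\<lambda>t :: real ^ 'a. s *\<^sub>R t)"
      by (rule linear_scaleR)
    from polyfun_diff[OF polyfun_compose_linear[OF assms(1) this] polyfun_scale[OF assms(1)]]
    show "polyfun (\<lambda>t. g (s *\<^sub>R t) - of_real s ^ e * g t)" .
    fix t assume t: "t \<in> V"
    then have "s *\<^sub>R t \<in> V" using assms(2) by (simp add: subspace_scale)
    then have "of_real (x \<bullet> (s *\<^sub>R t)) * g (s *\<^sub>R t) = of_real s ^ Suc e * (of_real (x \<bullet> t) * g t)"
      using hom t s q unfolding homogeneous_on_def by metis
    then have "of_real s * (of_real (x \<bullet> t) * (g (s *\<^sub>R t) - of_real s ^ e * g t)) = 0"
      by (simp add: algebra_simps)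
    then show "of_real (x \<bullet> t) * (g (s *\<^sub>R t) - of_real s ^ e * g t) = 0"
      using s by (metis mult_eq_0_iff of_real_eq_0_iff)
  qed
  then show "g (s *\<^sub>R t) = of_real s ^ e * g t" by simp
qed

text \<open>Because e^x - 1 begins with x.t, multiplying by it raises the order by one and
  multiplies the component of degree e by x.t.\<close>

lemma jet_shift_low:
  assumes "\<And>j. j < e \<Longrightarrow> M (j, t) = 0"
  shows "j < Suc e \<Longrightarrow> jet_shift x M (j, t) - M (j, t) = 0"
    and "jet_shift x M (Suc e, t) - M (Suc e, t) = of_real (x \<bullet> t) * M (e, t)"
proof -
  have *: "jet_shift x M (j, t) = M (j, t) +
      (\<Sum>i<j. of_real ((x \<bullet> t) ^ Suc i / fact (Suc i)) * M (j - Suc i, t))" for j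
  proof (cases j)
    case (Suc k)
    show ?thesis
      unfolding jet_shift_def Suc prod.case sum.atMost_Suc_shift lessThan_Suc_atMost by simp
  qed (simp add: jet_shift_def)
  show "jet_shift x M (j, t) - M (j, t) = 0" if "j < Suc e"
    unfolding * using that assms by (auto intro!: sum.neutral)
  have "(\<Sum>i<Suc e. of_real ((x \<bullet> t) ^ Suc i / fact (Suc i)) * M (Suc e - Suc i, t)) =
      (\<Sum>i\<in>{0}. of_real ((x \<bullet> t) ^ Suc i / fact (Suc i)) * M (Suc e - Suc i, t))"
    by (rule sum.mono_neutral_right) (use assms in auto)
  then show "jet_shift x M (Suc e, t) - M (Suc e, t) = of_real (x \<bullet> t) * M (e, t)"
    unfolding * by simp
qed

text \<open>Since e^x is 1 where x.t = 0, corrections of the form (e^x - 1) M leave the restriction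
  to the contraction untouched.\<close>

lemma jet_shift_orthogonal:
  assumes "x \<bullet> t = 0"
  shows "jet_shift x M (j, t) = M (j, t)"
proof -
  have "jet_shift x M (j, t) = (\<Sum>i\<in>{0}. of_real ((x \<bullet> t) ^ i / fact i) * M (j - i, t))"
    unfolding jet_shift_def prod.case
    by (rule sum.mono_neutral_right) (use assms in auto)
  then show ?thesis by simp
qed

text \<open>The degree d is part of the induction because a lift from the contraction may have
  components below d that vanish only where x.t = 0. They are cleared in increasing order: only the
  lowest remaining component is known to lie in the kernel.\<close>

theorem in_kernel_imp_least_part:
  assumes "subspace U" "polyfun f" "in_kernel U X 1 f" "span (U \<union> set_mset X) = UNIV"
    and "unimodular_normals U X" "set_mset X \<subseteq> integer_points" "homogeneous_on (U\<^sup>\<bottom>) d f"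
  shows "\<exists>G\<in>jets (lattice_int U X). \<forall>t\<in>U\<^sup>\<bottom>. (\<forall>j<d. G (j, t) = 0) \<and> G (d, t) = f t"
  using assms
proof (induction X arbitrary: U f d)
  case empty
  have "span U = U"
    using empty.prems(1) span_eq_iff by blast
  then have U: "U = UNIV"
    using empty.prems(4) unfolding set_mset_empty Un_empty_right by (rule trans[OF sym])
  have "0 \<in> lattice_int U {#}"
    by (simp add: lattice_int_def U integer_points_def set_plus_def)
  then have "(\<lambda>jt. f 0 * jet 0 jt) \<in> jets (lattice_int U {#})"
    by (intro jets_scale jet_in_jets)
  \<comment> \<open>On the zero space only degree 0 can be nonzero: dilating the origin by 2 gives f
    0 = 2^d f 0.\<close>
  moreover have "f 0 = 0" if "d > 0"
  proof -
    have "f (2 *\<^sub>R 0) = of_real 2 ^ d * f 0"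
      using empty.prems(7) U unfolding homogeneous_on_def by (metis orthogonal_comp_UNIV singletonI zero_neq_numeral)
    moreover have "(2::complex) ^ d \<noteq> 1"
    proof
      assume "(2::complex) ^ d = 1"
      then have "norm ((2::complex) ^ d) = 1" by simp
      then have "(2::real) ^ d = 1" by (simp add: norm_power)
      then show False using that one_less_power[of "2::real" d] by simp
    qed
    ultimately show ?thesis by simp
  qed
  ultimately show ?case
    by (intro bexI[of _ "\<lambda>jt. f 0 * jet 0 jt"]) (cases "d = 0", auto simp: U jet_def)
next
  case (add x X)
  note IH = add.IH and U = add.prems(1) and f = add.prems(2) and ker = add.prems(3)
    and span = add.prems(4) and uni = add.prems(5) and hom = add.prems(7)
  have x_int: "x \<in> integer_points" and X_int: "set_mset X \<subseteq> integer_points"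
    using add.prems(6) by auto
  let ?\<sigma> = "lattice_int U (add_mset x X)"
  consider "x \<in> U" | "x \<notin> U" "span (U \<union> set_mset X) \<noteq> UNIV"
    | "x \<notin> U" "span (U \<union> set_mset X) = UNIV" by blast
  then show ?case
  proof cases
    case 1
    then have "U \<union> set_mset (add_mset x X) = U \<union> set_mset X" by auto
    then obtain G where "G \<in> jets (lattice_int U X)"
      "\<forall>t\<in>U\<^sup>\<bottom>. (\<forall>j<d. G (j, t) = 0) \<and> G (d, t) = f t"
      using IH[OF U f in_kernel_drop[OF ker 1] _ unimodular_normals_delete[OF uni] X_int hom] span
      by auto
    moreover have "jets (lattice_int U X) \<subseteq> jets ?\<sigma>"
      using lattice_int_shift(1) x_int by (intro jets_mono) blast
    ultimately show ?thesis by blast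
  next
    case 2
    obtain v where v: "facet_normal U X v" "off_count X v = 0" "v \<bullet> x \<noteq> 0"
      using facet_normal_coloop[OF span 2(2)] by blast
    \<comment> \<open>For a coloop, x is the only element off the hyperplane, so the internal
      exponent is 1 - 1 = 0 and f vanishes.\<close>
    then have "deg_below (U\<^sup>\<bottom>) v (off_count (add_mset x X) v - 1) f"
      using ker facet_normal_add_mset[OF v(1)] unfolding in_kernel_def by blast
    then have "deg_below (U\<^sup>\<bottom>) v 0 f"
      using v by simp
    then have "\<forall>t\<in>U\<^sup>\<bottom>. (\<forall>j<d. (0::complex) = 0) \<and> 0 = f t"
      using deg_below_0D by metis
    then show ?thesis
      by (intro bexI[OF _ jets_zero]) simp
  next
    case 3
    let ?U = "span (insert x U)"
    have sub: "?U\<^sup>\<bottom> \<subseteq> U\<^sup>\<bottom>"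
      by (auto simp: orthogonal_comp_insert_span)
    obtain w where w: "w \<in> U\<^sup>\<bottom>" "x \<bullet> w \<noteq> 0"
      using component_orthogonal[OF U 3(1)] by blast
    \<comment> \<open>Realizes q as the least part of some (e^x - 1) M, with M supplied by the
      deletion in degree one lower. Vanishing of N on the complement of ?U keeps the values already
      fixed there.\<close>
    have correction: "\<exists>N\<in>jets ?\<sigma>. (\<forall>t\<in>U\<^sup>\<bottom>. (\<forall>j<e. N (j, t) = 0) \<and> N (e, t) = q t) \<and>
        (\<forall>t\<in>?U\<^sup>\<bottom>. \<forall>j. N (j, t) = 0)"
      if q: "polyfun q" "in_kernel U (add_mset x X) 1 q" "homogeneous_on (U\<^sup>\<bottom>) e q"
        "\<And>t. t \<in> ?U\<^sup>\<bottom> \<Longrightarrow> q t = 0" for q e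
    proof (cases e)
      case 0
      \<comment> \<open>Degree 0 leaves no room for the factor x.t, but then q is constant along
        rays and vanishes at the origin.\<close>
      have "q t = 0" if "t \<in> U\<^sup>\<bottom>" for t
      proof -
        have "q 0 = q t"
          using q(3) that 0 unfolding homogeneous_on_def
          by (intro polyfun_invariant_dilation[OF q(1)]) simp
        moreover have "q 0 = 0"
          by (rule q(4)) (simp add: subspace_orthogonal_comp subspace_0)
        ultimately show ?thesis by simp
      qed
      then show ?thesis
        using 0 by (intro bexI[OF _ jets_zero]) simp
    next
      case (Suc e')
      obtain g where g: "polyfun g" "\<And>t. t \<in> U\<^sup>\<bottom> \<Longrightarrow> q t = of_real (x \<bullet> t) * g t"
        using polyfun_divide[OF q(1) U 3(1) q(4)] by blast
      have ker_g: "in_kernel U X 1 g"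
      proof (rule in_kernel_cancel[OF U 3(1) g(1)])
        \<comment> \<open>The deletion still spans in this case, so no facet hyperplane contains all
          of X.\<close>
        show "1 \<le> off_count X v" if "facet_normal U X v" for v
          using off_count_pos[OF 3(2) facet_normal_orthogonal[OF that]] that
          by (simp add: facet_normal_def Suc_leI)
        show "in_kernel U (add_mset x X) 1 (\<lambda>t. of_real (x \<bullet> t) * g t)"
          using q(2) in_kernel_cong[of U q, OF g(2)] by simp
      qed
      have "homogeneous_on (U\<^sup>\<bottom>) e' g"
        using homogeneous_on_cancel[OF g(1) subspace_orthogonal_comp w] q(3) g(2) Suc by blast
      then obtain M where M: "M \<in> jets (lattice_int U X)"
        "\<And>t j. t \<in> U\<^sup>\<bottom> \<Longrightarrow> j < e' \<Longrightarrow> M (j, t) = 0" "\<And>t. t \<in> U\<^sup>\<bottom> \<Longrightarrow> M (e', t) = g t"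
        using IH[OF U g(1) ker_g 3(2) unimodular_normals_delete[OF uni] X_int] by blast
      let ?N = "\<lambda>jt. jet_shift x M jt - M jt"
      have "jet_shift x M \<in> jets ?\<sigma>"
        using M(1) lattice_int_shift(2)[OF _ x_int] by (rule jet_shift_jets)
      moreover have "M \<in> jets ?\<sigma>"
        using M(1) jets_mono[of "lattice_int U X" ?\<sigma>] lattice_int_shift(1) x_int by blast
      ultimately have "?N \<in> jets ?\<sigma>"
        by (rule jets_diff)
      moreover have "?N (j, t) = 0" if "t \<in> U\<^sup>\<bottom>" "j < e" for t j
        using jet_shift_low(1)[of e' M t j x] M(2)[OF that(1)] that(2) Suc by simp
      moreover have "?N (e, t) = q t" if "t \<in> U\<^sup>\<bottom>" for t
        using jet_shift_low(2)[of e' M t x] M(2,3)[OF that] g(2)[OF that] Suc by simp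
      moreover have "?N (j, t) = 0" if "t \<in> ?U\<^sup>\<bottom>" for t j
        using that by (simp add: jet_shift_orthogonal orthogonal_comp_insert_span)
      ultimately show ?thesis
        by (intro bexI[of _ ?N]) simp_all
    qed
    have "span (?U \<union> set_mset X) = UNIV"
      using span by (simp add: span_Un_span)
    moreover have "homogeneous_on (?U\<^sup>\<bottom>) d f"
      using hom sub unfolding homogeneous_on_def by blast
    ultimately obtain G' where G': "G' \<in> jets (lattice_int ?U X)"
      "\<forall>t\<in>?U\<^sup>\<bottom>. (\<forall>j<d. G' (j, t) = 0) \<and> G' (d, t) = f t"
      using IH[OF subspace_span f in_kernel_contract[OF ker] _ unimodular_normals_contract[OF uni]
          X_int] by blast
    have "\<exists>\<beta>\<in>?\<sigma>. \<forall>t\<in>?U\<^sup>\<bottom>. \<beta> \<bullet> t = \<alpha> \<bullet> t" if \<alpha>: "\<alpha> \<in> lattice_int ?U X" for \<alpha>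
    proof -
      obtain k where "\<alpha> - of_int k *\<^sub>R x \<in> ?\<sigma>"
        using lattice_int_lift[OF U 3(2) x_int \<alpha>] by blast
      then show ?thesis
        by (rule bexI[rotated]) (simp add: orthogonal_comp_insert_span inner_diff_left)
    qed
    from jets_lift[OF G'(1) this] obtain G0 where
      "G0 \<in> jets ?\<sigma>" "\<forall>j. \<forall>t\<in>?U\<^sup>\<bottom>. G0 (j, t) = G' (j, t)" by blast
    then have G0: "G0 \<in> jets ?\<sigma> \<and> (\<forall>t\<in>?U\<^sup>\<bottom>. (\<forall>j<d. G0 (j, t) = 0) \<and> G0 (d, t) = f t)"
      using G'(2) by simp
    \<comment> \<open>Invariant of the clearing: below e everything vanishes on all of
      \<open>U\<^sup>\<bottom>\<close>, while on the smaller complement the prescribed values up to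
      degree d persist.\<close>
    have "\<exists>G\<in>jets ?\<sigma>. (\<forall>t\<in>U\<^sup>\<bottom>. \<forall>j<e. G (j, t) = 0) \<and>
        (\<forall>t\<in>?U\<^sup>\<bottom>. (\<forall>j<d. G (j, t) = 0) \<and> G (d, t) = f t)" if "e \<le> d" for e
      using that
    proof (induction e)
      case 0
      then show ?case using G0 by blast
    next
      case (Suc e)
      then obtain G where G: "G \<in> jets ?\<sigma>" "\<And>t j. t \<in> U\<^sup>\<bottom> \<Longrightarrow> j < e \<Longrightarrow> G (j, t) = 0"
        "\<And>t j. t \<in> ?U\<^sup>\<bottom> \<Longrightarrow> j < d \<Longrightarrow> G (j, t) = 0" "\<And>t. t \<in> ?U\<^sup>\<bottom> \<Longrightarrow> G (d, t) = f t"
        by auto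
      have ker_e: "in_kernel U (add_mset x X) 1 (\<lambda>t. G (e, t))"
        using jets_in_kernel[OF G(1) uni] G(2) by blast
      have hom_e: "homogeneous_on (U\<^sup>\<bottom>) e (\<lambda>t. G (e, t))"
        unfolding homogeneous_on_def using jets_homogeneous[OF G(1)] by blast
      have "G (e, t) = 0" if "t \<in> ?U\<^sup>\<bottom>" for t
        using G(3)[OF that] Suc.prems by simp
      from correction[OF jets_polyfun[OF G(1)] ker_e hom_e this]
      obtain N where N: "N \<in> jets ?\<sigma>"
        "\<And>t j. t \<in> U\<^sup>\<bottom> \<Longrightarrow> j < e \<Longrightarrow> N (j, t) = 0" "\<And>t. t \<in> U\<^sup>\<bottom> \<Longrightarrow> N (e, t) = G (e, t)"
        "\<And>t j. t \<in> ?U\<^sup>\<bottom> \<Longrightarrow> N (j, t) = 0"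
        by blast
      show ?case
        by (rule bexI[OF _ jets_diff[OF G(1) N(1)]]) (use G N in \<open>auto simp: less_Suc_eq\<close>)
    qed
    from this[of d] obtain G where G: "G \<in> jets ?\<sigma>"
      "\<And>t j. t \<in> U\<^sup>\<bottom> \<Longrightarrow> j < d \<Longrightarrow> G (j, t) = 0" "\<And>t. t \<in> ?U\<^sup>\<bottom> \<Longrightarrow> G (d, t) = f t"
      by auto
    have ker_d: "in_kernel U (add_mset x X) 1 (\<lambda>t. f t - G (d, t))"
      using in_kernel_diff[OF ker jets_in_kernel[OF G(1) uni]] G(2) by blast
    have hom_d: "homogeneous_on (U\<^sup>\<bottom>) d (\<lambda>t. f t - G (d, t))"
      using hom jets_homogeneous[OF G(1)] unfolding homogeneous_on_def
      by (simp add: right_diff_distrib)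
    \<comment> \<open>One more correction, now added in degree d itself, turns agreement where x.t =
      0 into agreement on \<open>U\<^sup>\<bottom>\<close>.\<close>
    have "f t - G (d, t) = 0" if "t \<in> ?U\<^sup>\<bottom>" for t
      using G(3)[OF that] by simp
    from correction[OF polyfun_diff[OF f jets_polyfun[OF G(1), of d]] ker_d hom_d this]
    obtain N where N: "N \<in> jets ?\<sigma>"
      "\<And>t j. t \<in> U\<^sup>\<bottom> \<Longrightarrow> j < d \<Longrightarrow> N (j, t) = 0" "\<And>t. t \<in> U\<^sup>\<bottom> \<Longrightarrow> N (d, t) = f t - G (d, t)"
      by blast
    show ?thesis
      by (rule bexI[OF _ jets_add[OF G(1) N(1)]]) (use G N in auto)
  qed
qed

section \<open>Unimodular configurations\<close>

lemma parallel_if_hyperplane: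
  fixes v w :: "'a::real_inner"
  assumes "v \<noteq> 0" "\<And>z. v \<bullet> z = 0 \<Longrightarrow> w \<bullet> z = 0"
  shows "w = ((w \<bullet> v) / (v \<bullet> v)) *\<^sub>R v"
proof -
  let ?u = "w - ((w \<bullet> v) / (v \<bullet> v)) *\<^sub>R v"
  have "v \<bullet> ?u = 0"
    using assms(1) by (simp add: inner_diff_right inner_commute)
  then have "w \<bullet> ?u = 0" by (rule assms(2))
  then have "?u \<bullet> ?u = 0"
    using \<open>v \<bullet> ?u = 0\<close> by (simp add: inner_diff_left)
  then show ?thesis by simp
qed

text \<open>Fix a basis of the hyperplane inside X and let one further row of the determinant vary.
  This linear form vanishes on the hyperplane, so it is given by a multiple of v; it is integral on
  Z^n and, by unimodularity, 1 or -1 on elements of X off the hyperplane.\<close>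

lemma unimodular_imp_unimodular_normals:
  fixes X :: "(real ^ 'n::finite) multiset"
  assumes uni: "unimodular X" and spanning: "span (set_mset X) = UNIV"
  shows "unimodular_normals {0} X"
  unfolding unimodular_normals_def
proof (intro allI impI)
  fix v assume fn: "facet_normal {0} X v"
  let ?S = "{x \<in> set_mset X. v \<bullet> x = 0}"
  have v: "v \<noteq> 0" and S: "span ?S = {z. v \<bullet> z = 0}"
    using fn by (auto simp: facet_normal_def)
  have X_int: "set_mset X \<subseteq> integer_points"
    using uni by (simp add: unimodular_def)
  obtain B0 where B0: "B0 \<subseteq> ?S" "independent B0" "?S \<subseteq> span B0"
    by (rule maximal_independent_subset)
  have span_B0: "span B0 = {z. v \<bullet> z = 0}"
    using B0(1,3) S span_mono[OF B0(1)] span_minimal[OF B0(3) subspace_span] by simp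
  have indep: "independent (insert x B0)" and span_B: "span (insert x B0) = UNIV"
    and notin: "x \<notin> B0" if x: "v \<bullet> x \<noteq> 0" for x
  proof -
    show "x \<notin> B0" using B0(1) x by blast
    then show "independent (insert x B0)"
      using B0(2) span_B0 x by (simp add: independent_insert)
    have "z \<in> span (insert x B0)" for z
    proof -
      have "z - ((v \<bullet> z) / (v \<bullet> x)) *\<^sub>R x \<in> span B0"
        unfolding span_B0 using x by (simp add: inner_diff_right)
      then show ?thesis unfolding span_insert by blast
    qed
    then show "span (insert x B0) = UNIV" by blast
  qed
  obtain x0 where x0: "x0 \<in># X" "v \<bullet> x0 \<noteq> 0"
    using orthogonal_span_UNIV[OF spanning] v by blast
  have "card (insert x0 B0) = dim (UNIV :: (real ^ 'n) set)"
    using indep[OF x0(2)] span_B[OF x0(2)] by (intro basis_card_eq_dim) auto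
  then have "card (insert x0 B0) = CARD('n)" by simp
  moreover have "finite (insert x0 B0)"
    using indep[OF x0(2)] by (rule independent_imp_finite)
  ultimately obtain b where b: "bij_betw b (UNIV :: 'n set) (insert x0 B0)"
    using finite_same_card_bij[of "UNIV :: 'n set" "insert x0 B0"] by auto
  then obtain i0 where i0: "b i0 = x0"
    by (metis bij_betw_imp_surj_on insertI1 rangeE)
  have b_i: "b i \<in> B0" if "i \<noteq> i0" for i
    using b that i0 by (metis UNIV_I bij_betwE bij_betw_imp_inj_on inj_on_eq_iff insertE)
  have B0_b: "\<exists>i. i \<noteq> i0 \<and> b i = z" if "z \<in> B0" for z
    using b that i0 notin[OF x0(2)] by (metis bij_betw_imp_surj_on insertI2 rangeE)
  define L where "L = (\<lambda>z. det (\<chi> i. if i = i0 then z else b i))"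
  have "linear L"
  proof (rule linearI)
    show "L (y + z) = L y + L z" for y z
      unfolding L_def by (rule det_row_add)
    show "L (c *\<^sub>R z) = c *\<^sub>R L z" for c z
      unfolding L_def
      using det_row_mul[of i0 c "\<lambda>_. z" b, unfolded scalar_mult_eq_scaleR] by simp
  qed
  \<comment> \<open>The vector representing the linear form L, extracted as an adjoint.\<close>
  define w where "w = adjoint L 1"
  have w: "w \<bullet> z = L z" for z
    using adjoint_works[OF \<open>linear L\<close>, of z 1] by (simp add: w_def inner_commute)
  have "L z = 0" if "v \<bullet> z = 0" for z
  proof -
    have "z \<in> span B0" using that span_B0 by simp
    then show ?thesis
    proof (induction rule: span_induct)
      case base
      show ?case using \<open>linear L\<close> by (simp add: linear_subspace_kernel)
    next
      case (step z)
      then obtain i where i: "i \<noteq> i0" "b i = z" using B0_b by blast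
      show ?case
        unfolding L_def by (rule det_identical_rows[OF i(1)]) (use i in \<open>simp add: row_def\<close>)
    qed
  qed
  then have "w = ((w \<bullet> v) / (v \<bullet> v)) *\<^sub>R v"
    by (intro parallel_if_hyperplane v) (simp add: w)
  then obtain c where par: "w = c *\<^sub>R v" by blast
  have unit: "L x \<in> {-1, 1}" if x: "x \<in># X" "v \<bullet> x \<noteq> 0" for x
  proof -
    \<comment> \<open>Exchanging x0 for x in the varying row yields another ordered basis from
      X.\<close>
    let ?b = "b(i0 := x)"
    have "inj ?b"
      using b_i bij_betw_imp_inj_on[OF b] notin[OF x(2)]
      by (auto simp: inj_on_def)
    moreover have "range ?b = insert x B0"
      using b_i B0_b by (fastforce simp: image_iff)
    ultimately have "bij_betw ?b UNIV (insert x B0)"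
      by (simp add: bij_betw_def)
    moreover have "insert x B0 \<subseteq> set_mset X"
      using x(1) B0(1) by auto
    ultimately have "det (\<chi> i. ?b i) = 1 \<or> det (\<chi> i. ?b i) = -1"
      using uni indep[OF x(2)] span_B[OF x(2)] unfolding unimodular_def by blast
    moreover have "(\<chi> i. ?b i) = (\<chi> i. if i = i0 then x else b i)"
      by (simp add: vec_eq_iff)
    ultimately show ?thesis by (auto simp: L_def)
  qed
  have int: "L z \<in> \<int>" if z: "z \<in> integer_points" for z
  proof -
    have "(if i = i0 then z else b i) \<in> integer_points" for i
      using z b_i[of i] B0(1) X_int by auto
    then have "(if i = i0 then z else b i) $ j \<in> \<int>" for i j
      by (simp add: integer_points_def)
    then show ?thesis
      unfolding L_def det_def by (intro Ints_sum Ints_mult Ints_prod) auto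
  qed
  show "\<exists>c. c \<noteq> 0 \<and> (\<forall>z\<in>integer_points. (c *\<^sub>R v) \<bullet> z \<in> \<int>) \<and>
      (\<forall>x\<in>#X. (c *\<^sub>R v) \<bullet> x \<in> {-1, 0, 1})"
  proof (intro exI[of _ c] conjI ballI)
    show "c \<noteq> 0"
      using unit[OF x0] w[of x0] par by auto
    show "(c *\<^sub>R v) \<bullet> z \<in> \<int>" if "z \<in> integer_points" for z
      unfolding par[symmetric] w by (rule int[OF that])
    show "(c *\<^sub>R v) \<bullet> x \<in> {-1, 0, 1}" if "x \<in># X" for x
      unfolding par[symmetric] w
      using unit[OF that] \<open>\<And>z. v \<bullet> z = 0 \<Longrightarrow> L z = 0\<close>[of x] by auto
  qed
qed

section \<open>The spaces of the theorem as relative spaces\<close>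

lemma facet_hyperplane_normal:
  fixes X :: "(real ^ 'n::finite) multiset"
  assumes H: "H \<in> facet_hyperplanes X" and v: "v \<noteq> 0" "\<forall>h\<in>H. v \<bullet> h = 0"
  shows "H = {z. v \<bullet> z = 0}" "facet_normal {0} X v" "hyperplane_mult X H = off_count X v"
proof -
  have H': "subspace H" "dim H = CARD('n) - 1" "span (set_mset X \<inter> H) = H"
    using H by (auto simp: facet_hyperplanes_def)
  have "dim {z. v \<bullet> z = 0} = CARD('n) - 1"
    using dim_hyperplane[OF v(1)] by simp
  then show eq: "H = {z. v \<bullet> z = 0}"
    using H' v(2) by (intro subspace_dim_equal) (auto simp: subspace_hyperplane)
  have "{x \<in> set_mset X. v \<bullet> x = 0} = set_mset X \<inter> H"
    using eq by auto
  then show "facet_normal {0} X v"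
    using H'(3) v(1) eq by (simp add: facet_normal_def)
  show "hyperplane_mult X H = off_count X v"
    by (simp add: hyperplane_mult_def off_count_def eq)
qed

lemma facet_normal_hyperplane:
  fixes X :: "(real ^ 'n::finite) multiset"
  assumes "facet_normal {0} X v"
  shows "{z. v \<bullet> z = 0} \<in> facet_hyperplanes X"
proof -
  have v: "v \<noteq> 0" "span {x \<in> set_mset X. v \<bullet> x = 0} = {z. v \<bullet> z = 0}"
    using assms by (auto simp: facet_normal_def)
  have "set_mset X \<inter> {z. v \<bullet> z = 0} = {x \<in> set_mset X. v \<bullet> x = 0}"
    by auto
  then show ?thesis
    using v dim_hyperplane[OF v(1)] by (simp add: facet_hyperplanes_def subspace_hyperplane)
qed

lemma ideal_ker_span: "ideal_ker (cpoly_ideal.span Q) = {p. \<forall>q\<in>Q. diff_op q p = 0}"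
proof -
  have "diff_op q p = 0" if "\<forall>q\<in>Q. diff_op q p = 0" "q \<in> cpoly_ideal.span Q" for p q
    using that(2)
  proof (induction rule: cpoly_ideal.span_induct_alt)
    case (step c x y)
    then show ?case using that(1) by (simp add: diff_op_add_left diff_op_mult)
  qed simp
  then show ?thesis
    unfolding ideal_ker_def using cpoly_ideal.span_base by blast
qed

text \<open>The ideal uses one chosen normal per hyperplane, \<open>in_kernel\<close> all of them.
  Normals of the same hyperplane are parallel, and a degree bound is insensitive to scaling the
  direction.\<close>

lemma ideal_ker_I_minus:
  fixes X :: "(real ^ 'n::finite) multiset"
  assumes normal: "\<And>H. H \<in> facet_hyperplanes X \<Longrightarrow> \<eta> H \<noteq> 0 \<and> (\<forall>h\<in>H. \<eta> H \<bullet> h = 0)"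
  shows "p \<in> ideal_ker (I_minus X \<eta>) \<longleftrightarrow> in_kernel {0} X 1 (peval p)"
proof -
  have "p \<in> ideal_ker (I_minus X \<eta>) \<longleftrightarrow>
      (\<forall>H\<in>facet_hyperplanes X. deg_below UNIV (\<eta> H) (hyperplane_mult X H - 1) (peval p))"
    unfolding I_minus_def ideal_ker_span deg_below_UNIV_peval by auto
  also have "\<dots> \<longleftrightarrow> in_kernel {0} X 1 (peval p)"
    unfolding in_kernel_def orthogonal_comp_null
  proof safe
    fix v assume *: "\<forall>H\<in>facet_hyperplanes X.
        deg_below UNIV (\<eta> H) (hyperplane_mult X H - 1) (peval p)"
      and v: "facet_normal {0} X v"
    let ?H = "{z. v \<bullet> z = 0}"
    have H: "?H \<in> facet_hyperplanes X" using v by (rule facet_normal_hyperplane)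
    have n: "\<eta> ?H \<noteq> 0" "\<forall>h\<in>?H. \<eta> ?H \<bullet> h = 0" using normal[OF H] by auto
    have "v = ((v \<bullet> \<eta> ?H) / (\<eta> ?H \<bullet> \<eta> ?H)) *\<^sub>R \<eta> ?H"
      using facet_hyperplane_normal(1)[OF H n] by (intro parallel_if_hyperplane n(1)) auto
    moreover have "hyperplane_mult X ?H = off_count X v"
      by (simp add: hyperplane_mult_def off_count_def)
    ultimately show "deg_below UNIV v (off_count X v - 1) (peval p)"
      using deg_below_scaleR[OF *[rule_format, OF H]] by metis
  next
    fix H assume *: "\<forall>v. facet_normal {0} X v \<longrightarrow> deg_below UNIV v (off_count X v - 1) (peval p)"
      and H: "H \<in> facet_hyperplanes X"
    show "deg_below UNIV (\<eta> H) (hyperplane_mult X H - 1) (peval p)"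
      using * normal[OF H] facet_hyperplane_normal(2,3)[OF H] by metis
  qed
  finally show ?thesis .
qed

lemma P_central_iff: "p \<in> P_central W \<longleftrightarrow> peval p \<in> P_rel {0} W"
proof -
  have full: "dim S = CARD('a) \<longleftrightarrow> span S = UNIV" for S :: "(real ^ 'a) set"
    using dim_eq_full[of S] by simp
  have prod: "peval (prod_form Y) = (\<lambda>t. \<Prod>y\<in>#Y. of_real (y \<bullet> t))" for Y :: "(real ^ 'a) multiset"
    by (rule ext) (rule peval_prod_form)
  have 1: "peval q \<in> P_rel {0} W" if "q \<in> P_central W" for q
    using that unfolding P_central_def
  proof (induction rule: cpoly.span_induct_alt)
    case base
    have "peval (0 :: 'a cpoly) = 0" by (simp add: fun_eq_iff)
    then show ?case using P_rel_0 by metis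
  next
    case (step c x y)
    then obtain Y where Y: "x = prod_form Y" "Y \<subseteq># W" "span (set_mset (W - Y)) = UNIV"
      unfolding full by blast
    have "peval x \<in> P_rel {0} W"
      unfolding P_rel_def by (rule cfun.span_base) (use Y in \<open>auto simp: prod\<close>)
    then have "(\<lambda>t. c * peval x t) + peval y \<in> P_rel {0} W"
      using step.IH unfolding P_rel_def by (intro cfun.span_add cfun.span_scale)
    moreover have "peval (pscale c x + y) = (\<lambda>t. c * peval x t) + peval y"
      by (simp add: fun_eq_iff peval_add peval_pscale)
    ultimately show ?case by (simp only:)
  qed
  have 2: "\<exists>q\<in>P_central W. f = peval q" if "f \<in> P_rel {0} W" for f
    using that unfolding P_rel_def
  proof (induction rule: cfun.span_induct_alt)
    case base
    show ?case
      by (rule bexI[of _ 0]) (simp_all add: fun_eq_iff P_central_def cpoly.span_zero)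
  next
    case (step c g h)
    then obtain q where q: "q \<in> P_central W" "h = peval q" by blast
    obtain Y where Y: "g = peval (prod_form Y)" "Y \<subseteq># W" "span (set_mset (W - Y)) = UNIV"
      using step(1) by (auto simp: prod)
    have "prod_form Y \<in> P_central W"
      unfolding P_central_def by (rule cpoly.span_base) (use Y full in blast)
    then have "pscale c (prod_form Y) + q \<in> P_central W"
      using q(1) unfolding P_central_def by (intro cpoly.span_add cpoly.span_scale)
    moreover have "(\<lambda>t. c * g t) + h = peval (pscale c (prod_form Y) + q)"
      by (simp add: fun_eq_iff Y(1) q(2) peval_add peval_pscale)
    ultimately show ?case by blast
  qed
  show ?thesis
    using 1 2 peval_inject by metis
qed

text \<open>Every facet hyperplane H misses some x in X, and in X - x its multiplicity is m(H) - 1;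
  so the central bound there is the internal bound. Conversely, facets of X - x are facets of X, so
  internal conditions imply the central ones of each deletion.\<close>

theorem P_minus_eq_kernel:
  fixes X :: "(real ^ 'n::finite) multiset"
  assumes spanning: "span (set_mset X) = UNIV"
  shows "p \<in> P_minus X \<longleftrightarrow> in_kernel {0} X 1 (peval p)"
proof
  assume p: "p \<in> P_minus X"
  show "in_kernel {0} X 1 (peval p)"
    unfolding in_kernel_def orthogonal_comp_null
  proof (intro allI impI)
    fix v assume v: "facet_normal {0} X v"
    then have "v \<noteq> 0" by (simp add: facet_normal_def)
    then obtain x where x: "x \<in># X" "v \<bullet> x \<noteq> 0"
      using orthogonal_span_UNIV[OF spanning] by blast
    then have "peval p \<in> P_rel {0} (X - {#x#})"
      using p by (simp add: P_minus_def P_central_iff)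
    then have "deg_below UNIV v (off_count (X - {#x#}) v) (peval p)"
      using \<open>v \<noteq> 0\<close> by (intro P_rel_deg_below) auto
    moreover have "off_count X v = Suc (off_count (X - {#x#}) v)"
      using off_count_add_mset[of x "X - {#x#}" v] x by simp
    ultimately show "deg_below UNIV v (off_count X v - 1) (peval p)" by simp
  qed
next
  assume ker: "in_kernel {0} X 1 (peval p)"
  have "peval p \<in> P_rel {0} (X - {#x#})" if x: "x \<in># X" for x
  proof -
    let ?W = "X - {#x#}"
    have X: "X = add_mset x ?W" using x by simp
    have "in_kernel {0} ?W 0 (peval p)"
      unfolding in_kernel_def
    proof (intro allI impI)
      fix v assume v: "facet_normal {0} ?W v"
      then have "facet_normal {0} X v"
        using facet_normal_add_mset[OF v, of x] X by simp
      then have "deg_below ({0}\<^sup>\<bottom>) v (off_count X v - 1) (peval p)"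
        using ker unfolding in_kernel_def by blast
      \<comment> \<open>Removing one element lowers a multiplicity by at most one.\<close>
      moreover have "off_count X v - 1 \<le> off_count ?W v - 0"
        using off_count_add_mset[of x ?W v] X by (simp split: if_splits)
      ultimately show "deg_below ({0}\<^sup>\<bottom>) v (off_count ?W v - 0) (peval p)"
        by (rule deg_below_mono) simp
    qed
    moreover have "span ({0} \<union> set_mset (add_mset x ?W)) = UNIV"
      using spanning X by simp
    then have "span ({0} \<union> set_mset ?W) = UNIV \<or>
        (\<exists>v. facet_normal {0} ?W v \<and> off_count ?W v = 0)"
      using facet_normal_coloop by metis
    ultimately obtain h where "h \<in> P_rel {0} ?W" "\<forall>t\<in>{0}\<^sup>\<bottom>. peval p t = h t"
      using in_kernel_imp_P_rel[OF subspace_single_0 polyfun_peval] by metis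
    moreover from this have "peval p = h" by (simp add: fun_eq_iff)
    ultimately show ?thesis by simp
  qed
  then show "p \<in> P_minus X"
    by (simp add: P_minus_def P_central_iff)
qed

section \<open>Homogeneous components\<close>

abbreviation total_degree :: "('n::finite \<Rightarrow>\<^sub>0 nat) \<Rightarrow> nat" where
  "total_degree m \<equiv> (\<Sum>i\<in>UNIV. Poly_Mapping.lookup m i)"

definition hom_part :: "nat \<Rightarrow> ('n::finite) cpoly \<Rightarrow> 'n cpoly" where
  "hom_part d p = (\<Sum>m\<in>{m \<in> Poly_Mapping.keys p. total_degree m = d}.
     Poly_Mapping.single m (Poly_Mapping.lookup p m))"

lemma lookup_hom_part:
  "Poly_Mapping.lookup (hom_part d p) m = (if total_degree m = d then Poly_Mapping.lookup p m else 0)"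
  by (auto simp: hom_part_def lookup_sum lookup_single when_def in_keys_iff)

lemma homogeneous_hom_part: "homogeneous d (hom_part d p)"
  by (auto simp: homogeneous_def in_keys_iff lookup_hom_part split: if_splits)

text \<open>The free lower bound K lets a prescribed degree be included among the summands even if
  its component is zero.\<close>

lemma sum_hom_part: "\<exists>N>K. p = (\<Sum>d<N. hom_part d p)"
proof -
  define N where "N = Suc (max K (Max (insert 0 (total_degree ` Poly_Mapping.keys p))))"
  have "total_degree m < N" if "m \<in> Poly_Mapping.keys p" for m
  proof -
    have "total_degree m \<le> Max (insert 0 (total_degree ` Poly_Mapping.keys p))"
      by (rule Max_ge) (use that in auto)
    then show ?thesis by (simp add: N_def)
  qed
  then have "p = (\<Sum>d<N. hom_part d p)"
    by (intro poly_mapping_eqI) (auto simp: lookup_sum lookup_hom_part in_keys_iff)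
  moreover have "N > K" by (simp add: N_def)
  ultimately show ?thesis by blast
qed

lemma peval_homogeneous:
  assumes "homogeneous d p"
  shows "peval p (s *\<^sub>R t) = of_real s ^ d * peval p t"
proof -
  have "(\<Prod>i\<in>UNIV. complex_of_real ((s *\<^sub>R t) $ i) ^ Poly_Mapping.lookup m i) =
      of_real s ^ d * (\<Prod>i\<in>UNIV. of_real (t $ i) ^ Poly_Mapping.lookup m i)"
    if "m \<in> Poly_Mapping.keys p" for m
    using assms that by (auto simp: homogeneous_def power_mult_distrib prod.distrib power_sum)
  then show ?thesis
    by (simp add: peval_def sum_distrib_left mult.left_commute)
qed

lemma homogeneousI:
  assumes "\<And>s t. peval p (s *\<^sub>R t) = of_real s ^ d * peval p t"
  shows "homogeneous d p"
proof -
  obtain N where N: "N > d" "p = (\<Sum>d<N. hom_part d p)"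
    using sum_hom_part by blast
  \<comment> \<open>With p itself subtracted in degree d, the dilated sum is identically zero, so
    separating components inside the subspace {0} isolates degree d.\<close>
  define g where "g = (\<lambda>k t. peval (hom_part k p) t - (if k = d then peval p t else 0))"
  have "(\<lambda>t. \<Sum>k<N. of_real r ^ k * g k t) \<in> {0}" for r :: real
  proof -
    have "(\<Sum>k<N. of_real r ^ k * g k t) = 0" for t
    proof -
      have "(\<Sum>k<N. of_real r ^ k * peval (hom_part k p) t) = peval p (r *\<^sub>R t)"
        by (subst (2) N(2)) (simp add: peval_sum peval_homogeneous[OF homogeneous_hom_part])
      moreover have "(\<Sum>k<N. of_real r ^ k * (if k = d then peval p t else 0)) =
          of_real r ^ d * peval p t"
        using N(1) by (simp add: if_distrib cong: if_cong)
      ultimately show ?thesis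
        by (simp add: g_def right_diff_distrib sum_subtractf assms)
    qed
    then show ?thesis by (simp add: fun_eq_iff)
  qed
  then have "g d \<in> {0}"
    by (rule cfun_subspace_homogeneous_components[OF cfun.subspace_single_0 _ N(1)])
  then have "peval p = peval (hom_part d p)"
    by (auto simp: g_def fun_eq_iff)
  then have "p = hom_part d p" by (simp only: peval_inject)
  then show ?thesis using homogeneous_hom_part by metis
qed

text \<open>Degree bounds on lines through a subspace are preserved by dilations, so the components
  can be separated inside the space of functions obeying the bound.\<close>

lemma in_kernel_hom_part:
  assumes "in_kernel U X \<delta> (peval p)"
  shows "in_kernel U X \<delta> (peval (hom_part d p))"
  unfolding in_kernel_def
proof (intro allI impI)
  fix v assume v: "facet_normal U X v"
  let ?S = "{f. deg_below (U\<^sup>\<bottom>) v (off_count X v - \<delta>) f}"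
  obtain N where N: "N > d" "p = (\<Sum>d<N. hom_part d p)"
    using sum_hom_part by blast
  have "(\<lambda>t. \<Sum>k<N. of_real r ^ k * peval (hom_part k p) t) \<in> ?S" for r :: real
  proof -
    have "(\<Sum>k<N. of_real r ^ k * peval (hom_part k p) t) = peval p (r *\<^sub>R t)" for t
      by (subst (2) N(2)) (simp add: peval_sum peval_homogeneous[OF homogeneous_hom_part])
    moreover have "deg_below (U\<^sup>\<bottom>) v (off_count X v - \<delta>) (\<lambda>t. peval p (r *\<^sub>R t))"
      using assms v unfolding in_kernel_def
      by (intro deg_below_dilate subspace_orthogonal_comp) blast
    ultimately show ?thesis by simp
  qed
  then have "peval (hom_part d p) \<in> ?S"
    by (rule cfun_subspace_homogeneous_components[OF subspace_deg_below _ N(1)])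
  then show "deg_below (U\<^sup>\<bottom>) v (off_count X v - \<delta>) (peval (hom_part d p))"
    by simp
qed

section \<open>Expansions of exponential sums\<close>

text \<open>The constant term is the limit of the zero sum at 0; then the series is divided by x and
  the argument repeats. Only x different from 0 is assumed because the division needs it.\<close>

lemma real_powser_zero:
  fixes a :: "nat \<Rightarrow> real"
  assumes "\<And>x. x \<noteq> 0 \<Longrightarrow> (\<lambda>n. a n * x ^ n) sums 0"
  shows "a n = 0"
  using assms
proof (induction n arbitrary: a)
  have zero: "a 0 = 0" if "\<And>x. x \<noteq> 0 \<Longrightarrow> (\<lambda>n. a n * x ^ n) sums 0" for a :: "nat \<Rightarrow> real"
  proof -
    have "((\<lambda>_. 0) \<longlongrightarrow> a 0) (at (0::real))"
      using that by (intro powser_limit_0_strong[of 1]) auto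
    then show ?thesis
      by (simp add: tendsto_const_iff)
  qed
  {
    case 0
    then show ?case by (rule zero)
  next
    case (Suc n)
    have "(\<lambda>n. a (Suc n) * x ^ n) sums 0" if x: "x \<noteq> 0" for x
    proof -
      have "(\<lambda>n. a (Suc n) * x ^ Suc n) sums 0"
        using Suc.prems[OF x] zero[OF Suc.prems] by (subst sums_Suc_iff) simp
      from sums_mult[OF this, of "inverse x"] show ?thesis
        using x by (simp add: field_simps)
    qed
    then show ?case by (rule Suc.IH)
  }
qed

lemma complex_powser_unique:
  fixes a b :: "nat \<Rightarrow> complex"
  assumes "\<And>x::real. (\<lambda>n. of_real x ^ n * a n) sums f x" "\<And>x::real. (\<lambda>n. of_real x ^ n * b n) sums f x"
  shows "a = b"
proof
  fix n
  have diff: "(\<lambda>n. of_real x ^ n * (a n - b n)) sums 0" for x :: real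
    using sums_diff[OF assms(1)[of x] assms(2)[of x]] by (simp add: right_diff_distrib)
  have Re: "(\<lambda>n. Re (a n - b n) * x ^ n) sums 0" and Im: "(\<lambda>n. Im (a n - b n) * x ^ n) sums 0" for x :: real
    using sums_Re[OF diff[of x]] sums_Im[OF diff[of x]]
    by (simp_all add: mult.commute flip: of_real_power)
  have "Re (a n - b n) = 0" "Im (a n - b n) = 0"
    using real_powser_zero[OF Re] real_powser_zero[OF Im] by blast+
  then show "a n = b n" by (simp add: complex_eq_iff)
qed

section \<open>Passing between exponential sums and their homogeneous components\<close>

lemma jet_sums_exp: "(\<lambda>j. jet \<alpha> (j, t)) sums exp (of_real (\<alpha> \<bullet> t))"
  using exp_converges[of "complex_of_real (\<alpha> \<bullet> t)"]
  by (simp add: jet_def scaleR_conv_of_real field_simps)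

lemma Exp_space_jets:
  assumes "f \<in> Exp_space \<sigma>"
  shows "\<exists>G\<in>jets \<sigma>. \<forall>t. (\<lambda>j. G (j, t)) sums f t"
  using assms unfolding Exp_space_def
proof (induction rule: cfun.span_induct_alt)
  case base
  show ?case by (rule bexI[OF _ jets_zero]) simp
next
  case (step c x y)
  then obtain G \<alpha> where G: "G \<in> jets \<sigma>" "\<forall>t. (\<lambda>j. G (j, t)) sums y t"
    and \<alpha>: "\<alpha> \<in> \<sigma>" "x = (\<lambda>t. exp (of_real (\<alpha> \<bullet> t)))" by blast
  have "(\<lambda>jt. c * jet \<alpha> jt + G jt) \<in> jets \<sigma>"
    using G(1) \<alpha>(1) by (simp add: jets_add jets_scale jet_in_jets)
  moreover have "(\<lambda>j. c * jet \<alpha> (j, t) + G (j, t)) sums (c * x t + y t)" for t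
    unfolding \<alpha>(2) using G(2) by (intro sums_add sums_mult jet_sums_exp) simp
  ultimately show ?case
    by (intro bexI[of _ "\<lambda>jt. c * jet \<alpha> jt + G jt"]) simp_all
qed

lemma jets_Exp_space:
  assumes "G \<in> jets \<sigma>"
  shows "\<exists>f\<in>Exp_space \<sigma>. \<forall>t. (\<lambda>j. G (j, t)) sums f t"
  using assms
proof (induction rule: jets_induct)
  case zero
  show ?case
    by (rule bexI[of _ 0]) (simp_all add: Exp_space_def cfun.span_zero)
next
  case (step c \<alpha> G)
  then obtain f where f: "f \<in> Exp_space \<sigma>" "\<forall>t. (\<lambda>j. G (j, t)) sums f t" by blast
  let ?e = "\<lambda>t. exp (complex_of_real (\<alpha> \<bullet> t))"
  have "?e \<in> Exp_space \<sigma>"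
    using step(1) unfolding Exp_space_def by (intro cfun.span_base imageI)
  then have "(\<lambda>t. c * ?e t) + f \<in> Exp_space \<sigma>"
    using f(1) unfolding Exp_space_def by (intro cfun.span_add cfun.span_scale)
  moreover have "(\<lambda>j. c * jet \<alpha> (j, t) + G (j, t)) sums (c * ?e t + f t)" for t
    using f(2) by (intro sums_add sums_mult jet_sums_exp) simp
  ultimately show ?case
    by (intro bexI[of _ "(\<lambda>t. c * ?e t) + f"]) simp_all
qed

text \<open>\<open>Pi_space\<close> admits any homogeneous expansion, so it has to be identified
  with the jet. On the ray through t both are power series in the dilation factor with the same
  sum.\<close>

lemma homog_expansion_unique:
  assumes G: "G \<in> jets \<sigma>" "\<And>t. (\<lambda>j. G (j, t)) sums f t" and c: "homog_expansion f c"
  shows "peval (c j) t = G (j, t)"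
proof -
  have "(\<lambda>j. of_real x ^ j * peval (c j) t) sums f (x *\<^sub>R t)" for x :: real
  proof -
    have "(\<lambda>j. peval (c j) (x *\<^sub>R t)) sums f (x *\<^sub>R t)"
      using c by (simp add: homog_expansion_def)
    moreover have "peval (c j) (x *\<^sub>R t) = of_real x ^ j * peval (c j) t" for j
      using c by (intro peval_homogeneous) (simp add: homog_expansion_def)
    ultimately show ?thesis by simp
  qed
  moreover have "(\<lambda>j. of_real x ^ j * G (j, t)) sums f (x *\<^sub>R t)" for x :: real
    using G(2)[of "x *\<^sub>R t"] jets_homogeneous[OF G(1)] by simp
  ultimately have "(\<lambda>j. peval (c j) t) = (\<lambda>j. G (j, t))"
    by (rule complex_powser_unique)
  then show ?thesis by (rule fun_cong)
qed

lemma homog_expansion_exists: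
  assumes G: "G \<in> jets \<sigma>" "\<And>t. (\<lambda>j. G (j, t)) sums f t"
  obtains c where "homog_expansion f c" "\<And>j t. peval (c j) t = G (j, t)"
proof -
  have "\<exists>p. \<forall>t. peval p t = G (j, t)" for j
    using jets_polyfun[OF G(1), of j] unfolding polyfun_iff_peval by metis
  then obtain c where c: "\<And>j t. peval (c j) t = G (j, t)" by metis
  have "homogeneous j (c j)" for j
    by (rule homogeneousI) (simp add: c jets_homogeneous[OF G(1)])
  then have "homog_expansion f c"
    using G(2) by (simp add: homog_expansion_def c)
  then show ?thesis using that c by blast
qed

lemma Z_minus_eq_lattice_int: "Z_minus X = lattice_int {0} X"
  by (simp add: Z_minus_def lattice_int_def)

text \<open>The kernel is a subspace containing every least part, hence contains their span. A
  kernel element need not be homogeneous, so for the converse each homogeneous component is realized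
  separately and the components are added up in the span.\<close>

theorem Pi_space_eq_kernel:
  fixes X :: "(real ^ 'n::finite) multiset"
  assumes spanning: "span (set_mset X) = UNIV" and uni: "unimodular X"
  shows "p \<in> Pi_space (Z_minus X) \<longleftrightarrow> in_kernel {0} X 1 (peval p)"
proof
  note normals = unimodular_imp_unimodular_normals[OF uni spanning]
  let ?K = "{p. in_kernel {0} X 1 (peval p)}"
  have sub: "cpoly.subspace ?K"
    unfolding cpoly.subspace_def in_kernel_def
    by (simp add: deg_below_zero deg_below_add deg_below_scale peval_add[abs_def] peval_pscale[abs_def]
        peval_0[abs_def])
  have "least_part c \<in> ?K" if f: "f \<in> Exp_space (Z_minus X)" and c: "homog_expansion f c" for c f
  proof (cases "\<forall>j. c j = 0")
    case True
    then show ?thesis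
      using cpoly.subspace_0[OF sub] by (simp add: least_part_def)
  next
    case False
    let ?d = "LEAST j. c j \<noteq> 0"
    obtain G where G: "G \<in> jets (lattice_int {0} X)" "\<And>t. (\<lambda>j. G (j, t)) sums f t"
      using Exp_space_jets[OF f] by (auto simp: Z_minus_eq_lattice_int)
    have cG: "peval (c j) t = G (j, t)" for j t
      using homog_expansion_unique[OF G c] .
    have "G (j, t) = 0" if "j < ?d" for j t
      using not_less_Least[OF that] cG[of j t] by simp
    then have "in_kernel {0} X 1 (\<lambda>t. G (?d, t))"
      by (intro jets_in_kernel[OF G(1) normals])
    moreover have "peval (c ?d) = (\<lambda>t. G (?d, t))"
      using cG by blast
    ultimately show ?thesis
      using False by (auto simp: least_part_def)
  qed
  then have "Pi_space (Z_minus X) \<subseteq> ?K"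
    unfolding Pi_space_def by (intro cpoly.span_minimal sub) blast
  then show "in_kernel {0} X 1 (peval p)" if "p \<in> Pi_space (Z_minus X)"
    using that by blast
  show "p \<in> Pi_space (Z_minus X)" if ker: "in_kernel {0} X 1 (peval p)"
  proof -
    have part: "hom_part d p \<in> Pi_space (Z_minus X)" for d
    \<comment> \<open>Only a nonzero component is located by the least index in
      \<open>least_part\<close>; a zero one lies in the span anyway.\<close>
    proof (cases "hom_part d p = 0")
      case True
      then show ?thesis by (simp add: Pi_space_def cpoly.span_zero)
    next
      case False
      have "homogeneous_on ({0}\<^sup>\<bottom>) d (peval (hom_part d p))"
        by (simp add: homogeneous_on_def peval_homogeneous[OF homogeneous_hom_part])
      moreover have "set_mset X \<subseteq> integer_points"
        using uni by (simp add: unimodular_def)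
      moreover have "span ({0} \<union> set_mset X) = UNIV"
        using spanning by simp
      ultimately obtain G where G: "G \<in> jets (lattice_int {0} X)"
        "\<And>t j. j < d \<Longrightarrow> G (j, t) = 0" "\<And>t. G (d, t) = peval (hom_part d p) t"
        using in_kernel_imp_least_part[OF subspace_single_0 polyfun_peval
            in_kernel_hom_part[OF ker] _ normals] by (metis UNIV_I orthogonal_comp_null)
      obtain f where f: "f \<in> Exp_space (Z_minus X)" "\<And>t. (\<lambda>j. G (j, t)) sums f t"
        using jets_Exp_space[OF G(1)] by (auto simp: Z_minus_eq_lattice_int)
      obtain c where c: "homog_expansion f c" "\<And>j t. peval (c j) t = G (j, t)"
        using homog_expansion_exists[OF G(1) f(2)] by blast
      have cd: "c d = hom_part d p"
        unfolding peval_inject[symmetric] using c(2) G(3) by (intro ext) simp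
      have "c j = 0" if "j < d" for j
        using c(2)[of j] G(2)[OF that] peval_eq_0_iff[of "c j"] by simp
      then have "(LEAST j. c j \<noteq> 0) = d"
        using cd False by (intro Least_equality) (auto simp: not_less[symmetric])
      moreover have "\<not> (\<forall>j. c j = 0)"
        using cd False by metis
      ultimately have "least_part c = hom_part d p"
        using cd by (simp only: least_part_def if_False)
      then show ?thesis
        unfolding Pi_space_def using f(1) c(1) by (intro cpoly.span_base) force
    qed
    obtain N where "p = (\<Sum>d<N. hom_part d p)"
      using sum_hom_part by blast
    moreover have "(\<Sum>d<N. hom_part d p) \<in> Pi_space (Z_minus X)"
      using part unfolding Pi_space_def by (intro cpoly.span_sum)
    ultimately show ?thesis by simp
  qed
qed

theorem theorem5p10:
  fixes X :: "(real ^ 'n::finite) multiset"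
    and \<eta> :: "(real ^ 'n) set \<Rightarrow> real ^ 'n"
  assumes nonzero: "0 \<notin># X"
    and spanning: "span (set_mset X) = UNIV"
    and unimod: "unimodular X"
    and normal: "\<And>H. H \<in> facet_hyperplanes X \<Longrightarrow> \<eta> H \<noteq> 0 \<and> (\<forall>h\<in>H. \<eta> H \<bullet> h = 0)"
  shows "Pi_space (Z_minus X) = P_minus X \<and> P_minus X = ideal_ker (I_minus X \<eta>)"
  using Pi_space_eq_kernel[OF spanning unimod] P_minus_eq_kernel[OF spanning]
    ideal_ker_I_minus[of X \<eta>, OF normal]
  by blast

end
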